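(* Let $D$ be a finite-dimensional central division algebra over a field $F$, let $R$ be a commutative $F$-algebra, let $D_R=D\otimes_F R$ and let $n$ be a positive integer. For every submodule $N$ of the left $D_R$-module $(D_R)^n$ and every two-sided prime ideal $P$ of $D_R$ we have $$K(N,P)=\bigcap_{N\subseteq C_{P,\mathbf{u}}}C_{P,\mathbf{u}}$$ where $\mathbf{u}$ runs through $(D_R)^n\setminus P^n$.
   Context: Let $A$ be an associative ring with $1$ (here $A=D_R$) and $M=A^n$ as a left $A$-module. For a submodule $N$ of $M$, $(N:M):=\{a\in A\mid aM\subseteq N\}$. A two-sided ideal $P$ of $A$ is prime if $xAy\subseteq P$ implies $x\in P$ or $y\in P$. A submodule $N$ of $M$ is prime if for every $a\in A$ and $\mathbf{m}\in M$ such that $aA\mathbf{m}\subseteq N$ we have $a\in(N:M)$ or $\mathbf{m}\in N$. For a two-sided prime ideal $P$, a prime submodule $N$ with $(N:M)=P$ is called $P$-prime. An intersection of $P$-prime submodules is $P$-prime. $K(N,P)$ denotes the smallest $P$-prime submodule of $M$ containing $N$ if some $P$-prime submodule contains $N$, and $K(N,P)=M$ otherwise. For $\mathbf{u}=(u_1,\ldots,u_n)\in M\setminus P^n$, $C_{P,\mathbf{u}}:=\{\mathbf{m}\in M\mid\langle\mathbf{m},\mathbf{u}\rangle\in P\}$, where $\langle\mathbf{m},\mathbf{u}\rangle=\sum_{i=1}^n m_iu_i$. The intersection of the empty family of submodules of $M$ is $M$. *)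

theory Defs
  imports "HOL-Algebra.Algebra"
begin

section \<open>Associative algebras over a commutative ring\<close>

text \<open>
  The library locale \<^locale>\<open>algebra\<close> is restricted to commutative algebras; it is used below for
  commutative algebras only.
\<close>

locale assoc_algebra = module + M?: ring M +
  assumes smult_mult_left:
      "\<lbrakk> a \<in> carrier R; x \<in> carrier M; y \<in> carrier M \<rbrakk> \<Longrightarrow>
        (a \<odot>\<^bsub>M\<^esub> x) \<otimes>\<^bsub>M\<^esub> y = a \<odot>\<^bsub>M\<^esub> (x \<otimes>\<^bsub>M\<^esub> y)"
    and smult_mult_right:
      "\<lbrakk> a \<in> carrier R; x \<in> carrier M; y \<in> carrier M \<rbrakk> \<Longrightarrow>
        x \<otimes>\<^bsub>M\<^esub> (a \<odot>\<^bsub>M\<^esub> y) = a \<odot>\<^bsub>M\<^esub> (x \<otimes>\<^bsub>M\<^esub> y)"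

definition ring_center :: "('a, 'b) ring_scheme \<Rightarrow> 'a set"
  where "ring_center A =
    {z \<in> carrier A. \<forall>x \<in> carrier A. z \<otimes>\<^bsub>A\<^esub> x = x \<otimes>\<^bsub>A\<^esub> z}"

definition scalars :: "('f, 'a) ring_scheme \<Rightarrow> ('f, 'd, 'b) module_scheme \<Rightarrow> 'd set"
  where "scalars F D = (\<lambda>a. a \<odot>\<^bsub>D\<^esub> \<one>\<^bsub>D\<^esub>) ` carrier F"

text \<open>
  The library notion \<^const>\<open>ring.finite_dimension\<close> measures dimension over a subfield of the ring.
  Here the subfield is the image of \<open>F\<close> in \<open>D\<close>, and \<open>a \<odot> x = (a \<odot> \<one>) \<otimes> x\<close>, so this is the
  dimension of \<open>D\<close> as a vector space over \<open>F\<close>.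
\<close>

locale fin_dim_central_division_algebra =
  R?: field F + assoc_algebra F D for F (structure) and D (structure) +
  assumes one_neq_zero: "\<one>\<^bsub>D\<^esub> \<noteq> \<zero>\<^bsub>D\<^esub>"
    and division: "Units D = carrier D - {\<zero>\<^bsub>D\<^esub>}"
    and central: "ring_center D = scalars F D"
    and fin_dim: "ring.finite_dimension D (scalars F D) (carrier D)"


section \<open>Tensor products of algebras\<close>

text \<open>
  The free abelian group on \<open>D \<times> R\<close>, with the multiplication that extends
  \<open>(d, r) (d', r') = (d d', r r')\<close> bilinearly.
\<close>

definition free_pair_mult ::
    "('d, 'a) ring_scheme \<Rightarrow> ('r, 'b) ring_scheme \<Rightarrow>
      ('d \<times> 'r \<Rightarrow>\<^sub>0 int) \<Rightarrow> ('d \<times> 'r \<Rightarrow>\<^sub>0 int) \<Rightarrow> ('d \<times> 'r \<Rightarrow>\<^sub>0 int)"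
  where "free_pair_mult D R x y =
    frag_extend (\<lambda>p. frag_extend
      (\<lambda>q. frag_of (fst p \<otimes>\<^bsub>D\<^esub> fst q, snd p \<otimes>\<^bsub>R\<^esub> snd q)) y) x"

definition free_pair_ring ::
    "('d, 'a) ring_scheme \<Rightarrow> ('r, 'b) ring_scheme \<Rightarrow> ('d \<times> 'r \<Rightarrow>\<^sub>0 int) ring"
  where "free_pair_ring D R =
    \<lparr>carrier = carrier (free_Abelian_group (carrier D \<times> carrier R)),
      monoid.mult = free_pair_mult D R,
      one = frag_of (\<one>\<^bsub>D\<^esub>, \<one>\<^bsub>R\<^esub>),
      ring.zero = 0, ring.add = (+)\<rparr>"

definition tensor_relations ::
    "('f, 'c) ring_scheme \<Rightarrow> ('f, 'd, 'a) module_scheme \<Rightarrow> ('f, 'r, 'b) module_scheme \<Rightarrow>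
      ('d \<times> 'r \<Rightarrow>\<^sub>0 int) set"
  where "tensor_relations F D R =
    {frag_of (d \<oplus>\<^bsub>D\<^esub> d', r) - frag_of (d, r) - frag_of (d', r) | d d' r.
        d \<in> carrier D \<and> d' \<in> carrier D \<and> r \<in> carrier R} \<union>
    {frag_of (d, r \<oplus>\<^bsub>R\<^esub> r') - frag_of (d, r) - frag_of (d, r') | d r r'.
        d \<in> carrier D \<and> r \<in> carrier R \<and> r' \<in> carrier R} \<union>
    {frag_of (a \<odot>\<^bsub>D\<^esub> d, r) - frag_of (d, a \<odot>\<^bsub>R\<^esub> r) | a d r.
        a \<in> carrier F \<and> d \<in> carrier D \<and> r \<in> carrier R}"

definition tensor_kernel ::
    "('f, 'c) ring_scheme \<Rightarrow> ('f, 'd, 'a) module_scheme \<Rightarrow> ('f, 'r, 'b) module_scheme \<Rightarrow>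
      ('d \<times> 'r \<Rightarrow>\<^sub>0 int) set"
  where "tensor_kernel F D R =
    generate (free_Abelian_group (carrier D \<times> carrier R)) (tensor_relations F D R)"

text \<open>
  The quotient by the \<^emph>\<open>subgroup\<close> generated by the relations, as for tensor products of modules.
  This subgroup is an ideal (lemma \<open>ideal_tensor_kernel\<close>), so the multiplication
  of cosets is the usual \<open>(d \<otimes> r) (d' \<otimes> r') = d d' \<otimes> r r'\<close>.
\<close>

definition tensor_algebra ::
    "('f, 'c) ring_scheme \<Rightarrow> ('f, 'd, 'a) module_scheme \<Rightarrow> ('f, 'r, 'b) module_scheme \<Rightarrow>
      ('d \<times> 'r \<Rightarrow>\<^sub>0 int) set ring"
  where "tensor_algebra F D R = free_pair_ring D R Quot tensor_kernel F D R"

lemma free_pair_mult_of [simp]: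
  "free_pair_mult D R (frag_of p) (frag_of q) =
    frag_of (fst p \<otimes>\<^bsub>D\<^esub> fst q, snd p \<otimes>\<^bsub>R\<^esub> snd q)"
  by (simp add: free_pair_mult_def)

lemma free_pair_mult_0_left [simp]: "free_pair_mult D R 0 y = 0"
  by (simp add: free_pair_mult_def)

lemma free_pair_mult_0_right [simp]: "free_pair_mult D R x 0 = 0"
  by (simp add: free_pair_mult_def frag_extend_eq_0)

lemma free_pair_mult_add_left:
  "free_pair_mult D R (x + x') y = free_pair_mult D R x y + free_pair_mult D R x' y"
  by (simp add: free_pair_mult_def frag_extend_add)

lemma free_pair_mult_diff_left:
  "free_pair_mult D R (x - x') y = free_pair_mult D R x y - free_pair_mult D R x' y"
  by (simp add: free_pair_mult_def frag_extend_diff)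

lemma free_pair_mult_add_right:
  "free_pair_mult D R x (y + y') = free_pair_mult D R x y + free_pair_mult D R x y'"
  by (simp add: free_pair_mult_def frag_extend_add)
    (simp add: frag_extend_def frag_cmul_distrib2 sum.distrib)

lemma free_pair_mult_diff_right:
  "free_pair_mult D R x (y - y') = free_pair_mult D R x y - free_pair_mult D R x y'"
  using free_pair_mult_add_right[of D R x "y - y'" y'] by (simp add: algebra_simps)

lemma free_pair_mult_minus_left:
  "free_pair_mult D R (- x) y = - free_pair_mult D R x y"
  using free_pair_mult_diff_left[of D R 0 x y] by simp

lemma free_pair_mult_minus_right:
  "free_pair_mult D R x (- y) = - free_pair_mult D R x y"
  using free_pair_mult_diff_right[of D R x 0 y] by simp

lemma ring_free_pair_ring:
  assumes "ring D" "ring R"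
  shows "ring (free_pair_ring D R)"
proof -
  interpret D: ring D by fact
  interpret R: ring R by fact
  let ?S = "carrier D \<times> carrier R"
  let ?m = "free_pair_mult D R"
  have closed: "Poly_Mapping.keys (?m x y) \<subseteq> ?S"
    if "Poly_Mapping.keys x \<subseteq> ?S" "Poly_Mapping.keys y \<subseteq> ?S" for x y
    using that(1)
  proof (induction x rule: frag_induction)
    case (one p)
    from that(2) show ?case
    proof (induction y rule: frag_induction)
      case (one q)
      with \<open>p \<in> ?S\<close> show ?case by (auto simp: keys_frag_of)
    next
      case (diff a b)
      then show ?case
        using keys_diff[of "?m (frag_of p) a" "?m (frag_of p) b"]
        by (auto simp: free_pair_mult_diff_right)
    qed simp
  next
    case (diff a b)
    then show ?case
      using keys_diff[of "?m a y" "?m b y"] by (auto simp: free_pair_mult_diff_left)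
  qed simp
  have assoc: "?m (?m x y) z = ?m x (?m y z)"
    if "Poly_Mapping.keys x \<subseteq> ?S" "Poly_Mapping.keys y \<subseteq> ?S" "Poly_Mapping.keys z \<subseteq> ?S" for x y z
    using that(1)
  proof (induction x rule: frag_induction)
    case (one p)
    from that(2) show ?case
    proof (induction y rule: frag_induction)
      case (one q)
      from that(3) show ?case
      proof (induction z rule: frag_induction)
        case (one s)
        with \<open>p \<in> ?S\<close> \<open>q \<in> ?S\<close> show ?case by (auto simp: D.m_assoc R.m_assoc)
      qed (simp_all add: free_pair_mult_diff_right)
    qed (simp_all add: free_pair_mult_diff_left free_pair_mult_diff_right)
  qed (simp_all add: free_pair_mult_diff_left)
  have lone: "?m (frag_of (\<one>\<^bsub>D\<^esub>, \<one>\<^bsub>R\<^esub>)) x = x" if "Poly_Mapping.keys x \<subseteq> ?S" for x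
    using that by (induction x rule: frag_induction) (auto simp: free_pair_mult_diff_right)
  have rone: "?m x (frag_of (\<one>\<^bsub>D\<^esub>, \<one>\<^bsub>R\<^esub>)) = x" if "Poly_Mapping.keys x \<subseteq> ?S" for x
    using that by (induction x rule: frag_induction) (auto simp: free_pair_mult_diff_left)
  show ?thesis
  proof (rule ringI)
    show "abelian_group (free_pair_ring D R)"
    proof (rule abelian_groupI)
      fix x y
      assume "x \<in> carrier (free_pair_ring D R)" "y \<in> carrier (free_pair_ring D R)"
      then show "x \<oplus>\<^bsub>free_pair_ring D R\<^esub> y \<in> carrier (free_pair_ring D R)"
        using keys_add[of x y] by (auto simp: free_pair_ring_def)
    next
      fix x
      assume "x \<in> carrier (free_pair_ring D R)"
      then show "\<exists>y\<in>carrier (free_pair_ring D R).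
          y \<oplus>\<^bsub>free_pair_ring D R\<^esub> x = \<zero>\<^bsub>free_pair_ring D R\<^esub>"
        by (intro bexI[of _ "- x"]) (auto simp: free_pair_ring_def)
    qed (auto simp: free_pair_ring_def)
    show "Group.monoid (free_pair_ring D R)"
      by (rule Group.monoidI)
        (use closed in \<open>auto simp: free_pair_ring_def assoc lone rone keys_frag_of\<close>)
  qed (auto simp: free_pair_ring_def free_pair_mult_add_left free_pair_mult_add_right)
qed

lemma ideal_tensor_kernel:
  assumes "assoc_algebra F D" "assoc_algebra F R"
  shows "ideal (tensor_kernel F D R) (free_pair_ring D R)"
proof -
  interpret D: assoc_algebra F D by fact
  interpret R: assoc_algebra F R by fact
  interpret A: ring "free_pair_ring D R"
    by (intro ring_free_pair_ring D.ring_axioms R.ring_axioms)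
  let ?S = "carrier D \<times> carrier R"
  let ?G = "free_Abelian_group ?S"
  let ?m = "free_pair_mult D R"
  let ?K = "tensor_kernel F D R"
  interpret G: comm_group ?G by (rule abelian_free_Abelian_group)
  have rels: "tensor_relations F D R \<subseteq> carrier ?G"
    unfolding tensor_relations_def carrier_free_Abelian_group_iff
    by (auto simp: keys_frag_of dest!: set_mp[OF keys_diff])
  have sub: "subgroup ?K ?G"
    unfolding tensor_kernel_def by (rule G.generate_is_subgroup[OF rels])
  have G_inv: "inv\<^bsub>?G\<^esub> x = - x" if "x \<in> carrier ?G" for x
    using that by (simp add: carrier_free_Abelian_group_iff)
  have K_0: "0 \<in> ?K" using subgroup.one_closed[OF sub] by simp
  have K_add: "x + y \<in> ?K" if "x \<in> ?K" "y \<in> ?K" for x y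
    using subgroup.m_closed[OF sub that] by simp
  have K_minus: "- x \<in> ?K" if "x \<in> ?K" for x
    using subgroup.m_inv_closed[OF sub that] G_inv[of x] subgroup.mem_carrier[OF sub that] by simp
  have K_diff: "x - y \<in> ?K" if "x \<in> ?K" "y \<in> ?K" for x y
    using K_add[OF that(1) K_minus[OF that(2)]] by simp
  have K_rel: "x \<in> ?K" if "x \<in> tensor_relations F D R" for x
    unfolding tensor_kernel_def using that by (rule generate.incl)
  have rel_cases: thesis
    if "t \<in> tensor_relations F D R"
      and "\<And>d d' r. \<lbrakk> d \<in> carrier D; d' \<in> carrier D; r \<in> carrier R;
          t = frag_of (d \<oplus>\<^bsub>D\<^esub> d', r) - frag_of (d, r) - frag_of (d', r) \<rbrakk> \<Longrightarrow> thesis"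
      and "\<And>d r r'. \<lbrakk> d \<in> carrier D; r \<in> carrier R; r' \<in> carrier R;
          t = frag_of (d, r \<oplus>\<^bsub>R\<^esub> r') - frag_of (d, r) - frag_of (d, r') \<rbrakk> \<Longrightarrow> thesis"
      and "\<And>a d r. \<lbrakk> a \<in> carrier F; d \<in> carrier D; r \<in> carrier R;
          t = frag_of (a \<odot>\<^bsub>D\<^esub> d, r) - frag_of (d, a \<odot>\<^bsub>R\<^esub> r) \<rbrakk> \<Longrightarrow> thesis" for t thesis
    using that(1) unfolding tensor_relations_def
    by (elim UnE CollectE exE conjE) (rule that(2-4); assumption)+
  have rel1: "frag_of (d \<oplus>\<^bsub>D\<^esub> d', r) - frag_of (d, r) - frag_of (d', r) \<in> tensor_relations F D R"
    if "d \<in> carrier D" "d' \<in> carrier D" "r \<in> carrier R" for d d' r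
    using that unfolding tensor_relations_def by blast
  have rel2: "frag_of (d, r \<oplus>\<^bsub>R\<^esub> r') - frag_of (d, r) - frag_of (d, r') \<in> tensor_relations F D R"
    if "d \<in> carrier D" "r \<in> carrier R" "r' \<in> carrier R" for d r r'
    using that unfolding tensor_relations_def by blast
  have rel3: "frag_of (a \<odot>\<^bsub>D\<^esub> d, r) - frag_of (d, a \<odot>\<^bsub>R\<^esub> r) \<in> tensor_relations F D R"
    if "a \<in> carrier F" "d \<in> carrier D" "r \<in> carrier R" for a d r
    using that unfolding tensor_relations_def by blast
  have rel_left: "?m (frag_of p) t \<in> tensor_relations F D R"
    if p: "p \<in> ?S" and t: "t \<in> tensor_relations F D R" for p t
    using t
  proof (rule rel_cases)
    fix d d' r assume "d \<in> carrier D" "d' \<in> carrier D" "r \<in> carrier R"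
      "t = frag_of (d \<oplus>\<^bsub>D\<^esub> d', r) - frag_of (d, r) - frag_of (d', r)"
    then show ?thesis
      using p rel1[of "fst p \<otimes>\<^bsub>D\<^esub> d" "fst p \<otimes>\<^bsub>D\<^esub> d'" "snd p \<otimes>\<^bsub>R\<^esub> r"]
      by (auto simp: free_pair_mult_diff_right D.M.r_distr)
  next
    fix d r r' assume "d \<in> carrier D" "r \<in> carrier R" "r' \<in> carrier R"
      "t = frag_of (d, r \<oplus>\<^bsub>R\<^esub> r') - frag_of (d, r) - frag_of (d, r')"
    then show ?thesis
      using p rel2[of "fst p \<otimes>\<^bsub>D\<^esub> d" "snd p \<otimes>\<^bsub>R\<^esub> r" "snd p \<otimes>\<^bsub>R\<^esub> r'"]
      by (auto simp: free_pair_mult_diff_right R.M.r_distr)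
  next
    fix a d r assume "a \<in> carrier F" "d \<in> carrier D" "r \<in> carrier R"
      "t = frag_of (a \<odot>\<^bsub>D\<^esub> d, r) - frag_of (d, a \<odot>\<^bsub>R\<^esub> r)"
    then show ?thesis
      using p rel3[of a "fst p \<otimes>\<^bsub>D\<^esub> d" "snd p \<otimes>\<^bsub>R\<^esub> r"]
      by (auto simp: free_pair_mult_diff_right D.smult_mult_right R.smult_mult_right)
  qed
  have rel_right: "?m t (frag_of p) \<in> tensor_relations F D R"
    if p: "p \<in> ?S" and t: "t \<in> tensor_relations F D R" for p t
    using t
  proof (rule rel_cases)
    fix d d' r assume "d \<in> carrier D" "d' \<in> carrier D" "r \<in> carrier R"
      "t = frag_of (d \<oplus>\<^bsub>D\<^esub> d', r) - frag_of (d, r) - frag_of (d', r)"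
    then show ?thesis
      using p rel1[of "d \<otimes>\<^bsub>D\<^esub> fst p" "d' \<otimes>\<^bsub>D\<^esub> fst p" "r \<otimes>\<^bsub>R\<^esub> snd p"]
      by (auto simp: free_pair_mult_diff_left D.M.l_distr)
  next
    fix d r r' assume "d \<in> carrier D" "r \<in> carrier R" "r' \<in> carrier R"
      "t = frag_of (d, r \<oplus>\<^bsub>R\<^esub> r') - frag_of (d, r) - frag_of (d, r')"
    then show ?thesis
      using p rel2[of "d \<otimes>\<^bsub>D\<^esub> fst p" "r \<otimes>\<^bsub>R\<^esub> snd p" "r' \<otimes>\<^bsub>R\<^esub> snd p"]
      by (auto simp: free_pair_mult_diff_left R.M.l_distr)
  next
    fix a d r assume "a \<in> carrier F" "d \<in> carrier D" "r \<in> carrier R"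
      "t = frag_of (a \<odot>\<^bsub>D\<^esub> d, r) - frag_of (d, a \<odot>\<^bsub>R\<^esub> r)"
    then show ?thesis
      using p rel3[of a "d \<otimes>\<^bsub>D\<^esub> fst p" "r \<otimes>\<^bsub>R\<^esub> snd p"]
      by (auto simp: free_pair_mult_diff_left D.smult_mult_left R.smult_mult_left)
  qed
  have rel_left': "?m x t \<in> ?K"
    if "Poly_Mapping.keys x \<subseteq> ?S" "t \<in> tensor_relations F D R" for x t
    using that(1) by (induction x rule: frag_induction)
      (auto simp: K_0 free_pair_mult_diff_left K_diff intro: K_rel rel_left that(2))
  have rel_right': "?m t x \<in> ?K"
    if "Poly_Mapping.keys x \<subseteq> ?S" "t \<in> tensor_relations F D R" for x t
    using that(1) by (induction x rule: frag_induction)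
      (auto simp: K_0 free_pair_mult_diff_right K_diff intro: K_rel rel_right that(2))
  have left: "?m x t \<in> ?K" and right: "?m t x \<in> ?K"
    if "t \<in> ?K" "Poly_Mapping.keys x \<subseteq> ?S" for t x
  proof -
    have "?m x t \<in> ?K \<and> ?m t x \<in> ?K"
      using that(1) unfolding tensor_kernel_def
    proof (induction t rule: generate.induct)
      case one
      then show ?case using K_0 by (simp add: tensor_kernel_def)
    next
      case (incl h)
      then show ?case using rel_left' rel_right' that(2) by (simp add: tensor_kernel_def)
    next
      case (inv h)
      then have "inv\<^bsub>?G\<^esub> h = - h" using rels G_inv by blast
      then show ?case
        using K_minus[OF rel_left'[OF that(2) inv]] K_minus[OF rel_right'[OF that(2) inv]]
        by (simp add: tensor_kernel_def free_pair_mult_minus_left free_pair_mult_minus_right)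
    next
      case (eng h1 h2)
      then show ?case
        using K_add by (simp add: tensor_kernel_def free_pair_mult_add_left free_pair_mult_add_right)
    qed
    then show "?m x t \<in> ?K" "?m t x \<in> ?K" by auto
  qed
  show ?thesis
  proof (rule idealI[OF A.ring_axioms])
    have mon: "?K \<subseteq> carrier (free_pair_ring D R)"
      using subgroup.subset[OF sub] by (simp add: free_pair_ring_def)
    show "subgroup ?K (add_monoid (free_pair_ring D R))"
    proof (rule A.add.subgroupI[OF mon])
      fix x assume x: "x \<in> ?K"
      then have "x \<in> carrier (free_pair_ring D R)" "- x \<in> carrier (free_pair_ring D R)"
        using subgroup.mem_carrier[OF sub x] by (auto simp: free_pair_ring_def)
      then have "\<ominus>\<^bsub>free_pair_ring D R\<^esub> x = - x"
        by (intro A.minus_equality) (auto simp: free_pair_ring_def)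
      then show "\<ominus>\<^bsub>free_pair_ring D R\<^esub> x \<in> ?K" using x K_minus by simp
    qed (use K_0 K_add in \<open>auto simp: free_pair_ring_def\<close>)
  qed (use left right in \<open>auto simp: free_pair_ring_def\<close>)
qed

lemma (in algebra) assoc_algebra: "assoc_algebra R M"
proof (intro assoc_algebra.intro assoc_algebra_axioms.intro)
  show "x \<otimes>\<^bsub>M\<^esub> (a \<odot>\<^bsub>M\<^esub> y) = a \<odot>\<^bsub>M\<^esub> (x \<otimes>\<^bsub>M\<^esub> y)"
    if "a \<in> carrier R" "x \<in> carrier M" "y \<in> carrier M" for a x y
    using that smult_assoc2[of a y x] by (simp add: m_comm)
  show "ring M" by unfold_locales
qed (use module_axioms smult_assoc2 in auto)

lemma ring_tensor_algebra:
  assumes "assoc_algebra F D" "assoc_algebra F R"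
  shows "ring (tensor_algebra F D R)"
  unfolding tensor_algebra_def
  by (rule ideal.quotient_is_ring[OF ideal_tensor_kernel[OF assms]])


section \<open>Prime submodules\<close>

text \<open>
  The left module \<open>A\<^sup>n\<close>, with vectors indexed by \<open>{..<n}\<close>. The fields \<open>mult\<close> and \<open>one\<close> that the
  record type requires are the componentwise ones; they play no role in the module structure.
\<close>

definition power_module :: "('a, 'b) ring_scheme \<Rightarrow> nat \<Rightarrow> ('a, nat \<Rightarrow> 'a) module"
  where "power_module A n =
    \<lparr>carrier = {..<n} \<rightarrow>\<^sub>E carrier A,
      monoid.mult = (\<lambda>x y. \<lambda>i\<in>{..<n}. x i \<otimes>\<^bsub>A\<^esub> y i),
      one = (\<lambda>i\<in>{..<n}. \<one>\<^bsub>A\<^esub>),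
      ring.zero = (\<lambda>i\<in>{..<n}. \<zero>\<^bsub>A\<^esub>),
      ring.add = (\<lambda>x y. \<lambda>i\<in>{..<n}. x i \<oplus>\<^bsub>A\<^esub> y i),
      smult = (\<lambda>a x. \<lambda>i\<in>{..<n}. a \<otimes>\<^bsub>A\<^esub> x i)\<rparr>"

text \<open>
  \<^locale>\<open>primeideal\<close> is elementwise primeness of proper ideals in commutative rings. The
  notion below is for arbitrary rings and does not require \<open>P\<close> to be proper.
\<close>

definition two_sided_prime_ideal :: "('a, 'b) ring_scheme \<Rightarrow> 'a set \<Rightarrow> bool"
  where "two_sided_prime_ideal A P \<longleftrightarrow> ideal P A \<and>
    (\<forall>x \<in> carrier A. \<forall>y \<in> carrier A.
      (\<forall>a \<in> carrier A. x \<otimes>\<^bsub>A\<^esub> a \<otimes>\<^bsub>A\<^esub> y \<in> P) \<longrightarrow> x \<in> P \<or> y \<in> P)"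

definition module_colon ::
    "('a, 'b) ring_scheme \<Rightarrow> ('a, 'm, 'c) module_scheme \<Rightarrow> 'm set \<Rightarrow> 'a set"
  where "module_colon A M N = {a \<in> carrier A. \<forall>m \<in> carrier M. a \<odot>\<^bsub>M\<^esub> m \<in> N}"

definition prime_submodule ::
    "('a, 'b) ring_scheme \<Rightarrow> ('a, 'm, 'c) module_scheme \<Rightarrow> 'm set \<Rightarrow> bool"
  where "prime_submodule A M N \<longleftrightarrow> submodule N A M \<and>
    (\<forall>a \<in> carrier A. \<forall>m \<in> carrier M.
      (\<forall>b \<in> carrier A. (a \<otimes>\<^bsub>A\<^esub> b) \<odot>\<^bsub>M\<^esub> m \<in> N) \<longrightarrow> a \<in> module_colon A M N \<or> m \<in> N)"

definition P_prime_submodule ::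
    "('a, 'b) ring_scheme \<Rightarrow> ('a, 'm, 'c) module_scheme \<Rightarrow> 'a set \<Rightarrow> 'm set \<Rightarrow> bool"
  where "P_prime_submodule A M P N \<longleftrightarrow> prime_submodule A M N \<and> module_colon A M N = P"

definition prime_hull ::
    "('a, 'b) ring_scheme \<Rightarrow> ('a, 'm, 'c) module_scheme \<Rightarrow> 'm set \<Rightarrow> 'a set \<Rightarrow> 'm set"
  where "prime_hull A M N P =
    (if \<exists>L. P_prime_submodule A M P L \<and> N \<subseteq> L
     then (LEAST L. P_prime_submodule A M P L \<and> N \<subseteq> L)
     else carrier M)"

definition pairing :: "('a, 'b) ring_scheme \<Rightarrow> nat \<Rightarrow> (nat \<Rightarrow> 'a) \<Rightarrow> (nat \<Rightarrow> 'a) \<Rightarrow> 'a"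
  where "pairing A n m u = (\<Oplus>\<^bsub>A\<^esub>i\<in>{..<n}. m i \<otimes>\<^bsub>A\<^esub> u i)"

definition C_submodule ::
    "('a, 'b) ring_scheme \<Rightarrow> nat \<Rightarrow> 'a set \<Rightarrow> (nat \<Rightarrow> 'a) \<Rightarrow> (nat \<Rightarrow> 'a) set"
  where "C_submodule A n P u = {m \<in> carrier (power_module A n). pairing A n m u \<in> P}"

end

theory Submission
  imports Defs
begin

text \<open>
  Every \<open>C_submodule A n P u\<close> with \<open>u\<close> outside \<open>P\<^sup>n\<close> is \<open>P\<close>-prime, so everything comes down to
  separating a vector \<open>w\<close> from a \<open>P\<close>-prime submodule \<open>L\<close> by some \<open>u\<close>. For \<open>D\<close> central and finite
  dimensional, the coordinate functions with respect to a basis \<open>e\<close> of \<open>D\<close> have the form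
  \<open>x \<mapsto> \<Sum>s. e s * x * \<beta> j s\<close>. These formulas survive in \<open>A = D \<otimes> R\<close>, where they take values in the
  centre \<open>Z\<close>. As \<open>P\<close> meets \<open>Z\<close> in a prime ideal and the quotient by \<open>L\<close> is torsion free over
  \<open>Z / (P \<inter> Z)\<close>, commutative linear algebra gives a \<open>Z\<close>-linear functional that maps \<open>L\<close> into \<open>P\<close>, but
  not \<open>w\<close>. Rewritten in terms of \<open>e\<close> and \<open>\<beta>\<close> it becomes \<open>m \<mapsto> \<Sum>s. e s * \<langle>m, u s\<rangle>\<close>. Since \<open>L\<close> is a left
  submodule, each \<open>\<langle>m, u s\<rangle>\<close> lies in \<open>P\<close> for \<open>m\<close> in \<open>L\<close>, while some \<open>\<langle>w, u s\<rangle>\<close> does not.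
\<close>

section \<open>Separation in modules over a commutative ring\<close>

context module begin

lemma finsum_mem_submodule:
  assumes L: "submodule L R M" and "finite J" and "\<And>j. j \<in> J \<Longrightarrow> f j \<in> L"
  shows "finsum M f J \<in> L"
  using assms(2,3)
proof (induction J rule: finite_induct)
  case empty
  then show ?case using subgroup.one_closed[OF submodule.axioms(1)[OF L]] by simp
next
  case (insert j J)
  have "f \<in> insert j J \<rightarrow> carrier M" using insert.prems submoduleE(1)[OF L] by blast
  then show ?case using insert submoduleE(5)[OF L] by (simp add: Pi_iff)
qed

text \<open>Scalars outside \<open>p\<close> act injectively on the quotient by \<open>L\<close>.
  When \<open>p\<close> annihilates that quotient, this is torsion freeness over
  \<open>R / p\<close>.\<close>

definition saturated :: "'a set \<Rightarrow> 'c set \<Rightarrow> bool" where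
  "saturated p L \<longleftrightarrow> (\<forall>r \<in> carrier R - p. \<forall>x \<in> carrier M. r \<odot>\<^bsub>M\<^esub> x \<in> L \<longrightarrow> x \<in> L)"

text \<open>The saturation of \<open>L + R g\<close>: some multiple of \<open>x\<close> by a
  denominator outside \<open>p\<close> falls into that sum. Equivalently, \<open>x\<close> maps into
  the line spanned by \<open>g\<close> in the localization at \<open>p\<close> of the quotient by
  \<open>L\<close>.\<close>

definition saturated_extension :: "'a set \<Rightarrow> 'c set \<Rightarrow> 'c \<Rightarrow> 'c set" where
  "saturated_extension p L g =
    {x \<in> carrier M. \<exists>t \<in> carrier R - p. \<exists>s \<in> carrier R. t \<odot>\<^bsub>M\<^esub> x \<oplus>\<^bsub>M\<^esub> s \<odot>\<^bsub>M\<^esub> g \<in> L}"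

text \<open>Products of denominators stay outside the prime \<open>p\<close>. Hence sums can be
  brought to the common denominator \<open>t \<otimes> t'\<close>, and a scalar \<open>r\<close>
  outside \<open>p\<close> is absorbed into the denominator.\<close>

lemma
  assumes p: "primeideal p R" and L: "submodule L R M" and g: "g \<in> carrier M"
  shows submodule_saturated_extension: "submodule (saturated_extension p L g) R M"
    and saturated_saturated_extension: "saturated p (saturated_extension p L g)"
    and subset_saturated_extension: "L \<subseteq> saturated_extension p L g"
    and mem_saturated_extension: "g \<in> saturated_extension p L g"
proof -
  interpret p: primeideal p R by fact
  note LE = submoduleE[OF L]
  have zero_L: "\<zero>\<^bsub>M\<^esub> \<in> L" using subgroup.one_closed[OF submodule.axioms(1)[OF L]] by simp
  have one_p: "\<one> \<notin> p" using p.one_imp_carrier p.I_notcarr by blast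
  let ?E = "saturated_extension p L g"
  show sub: "L \<subseteq> ?E"
  proof
    fix x assume "x \<in> L"
    moreover have "x \<in> carrier M" using \<open>x \<in> L\<close> LE(1) by blast
    ultimately have "\<one> \<odot>\<^bsub>M\<^esub> x \<oplus>\<^bsub>M\<^esub> \<zero> \<odot>\<^bsub>M\<^esub> g \<in> L" using g by simp
    with \<open>x \<in> carrier M\<close> one_p show "x \<in> ?E"
      unfolding saturated_extension_def by blast
  qed
  have "\<one> \<odot>\<^bsub>M\<^esub> g \<oplus>\<^bsub>M\<^esub> (\<ominus> \<one>) \<odot>\<^bsub>M\<^esub> g \<in> L"
    using g zero_L by (simp add: smult_l_minus M.r_neg)
  with g one_p show "g \<in> ?E" unfolding saturated_extension_def by blast
  show "saturated p ?E" unfolding saturated_def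
  proof (intro ballI impI)
    fix r x assume r: "r \<in> carrier R - p" and x: "x \<in> carrier M" and "r \<odot>\<^bsub>M\<^esub> x \<in> ?E"
    then obtain t s where ts: "t \<in> carrier R - p" "s \<in> carrier R"
      "t \<odot>\<^bsub>M\<^esub> (r \<odot>\<^bsub>M\<^esub> x) \<oplus>\<^bsub>M\<^esub> s \<odot>\<^bsub>M\<^esub> g \<in> L" unfolding saturated_extension_def by blast
    then have "(t \<otimes> r) \<odot>\<^bsub>M\<^esub> x \<oplus>\<^bsub>M\<^esub> s \<odot>\<^bsub>M\<^esub> g \<in> L" using r x by (simp add: smult_assoc1)
    moreover have "t \<otimes> r \<in> carrier R - p" using ts r p.I_prime by auto
    ultimately show "x \<in> ?E" using x ts(2) unfolding saturated_extension_def by blast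
  qed
  have add: "x \<oplus>\<^bsub>M\<^esub> y \<in> ?E" if "x \<in> ?E" "y \<in> ?E" for x y
  proof -
    from that obtain t s t' s' where
      h: "x \<in> carrier M" "t \<in> carrier R - p" "s \<in> carrier R" "t \<odot>\<^bsub>M\<^esub> x \<oplus>\<^bsub>M\<^esub> s \<odot>\<^bsub>M\<^esub> g \<in> L"
      "y \<in> carrier M" "t' \<in> carrier R - p" "s' \<in> carrier R" "t' \<odot>\<^bsub>M\<^esub> y \<oplus>\<^bsub>M\<^esub> s' \<odot>\<^bsub>M\<^esub> g \<in> L"
      unfolding saturated_extension_def by blast
    have "t' \<odot>\<^bsub>M\<^esub> (t \<odot>\<^bsub>M\<^esub> x \<oplus>\<^bsub>M\<^esub> s \<odot>\<^bsub>M\<^esub> g) \<oplus>\<^bsub>M\<^esub> t \<odot>\<^bsub>M\<^esub> (t' \<odot>\<^bsub>M\<^esub> y \<oplus>\<^bsub>M\<^esub> s' \<odot>\<^bsub>M\<^esub> g) \<in> L"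
      using h(2,6) by (intro LE(5)[OF LE(4)[OF _ h(4)] LE(4)[OF _ h(8)]]) auto
    also have "t' \<odot>\<^bsub>M\<^esub> (t \<odot>\<^bsub>M\<^esub> x \<oplus>\<^bsub>M\<^esub> s \<odot>\<^bsub>M\<^esub> g) \<oplus>\<^bsub>M\<^esub> t \<odot>\<^bsub>M\<^esub> (t' \<odot>\<^bsub>M\<^esub> y \<oplus>\<^bsub>M\<^esub> s' \<odot>\<^bsub>M\<^esub> g) =
      (t \<otimes> t') \<odot>\<^bsub>M\<^esub> (x \<oplus>\<^bsub>M\<^esub> y) \<oplus>\<^bsub>M\<^esub> (t' \<otimes> s \<oplus> t \<otimes> s') \<odot>\<^bsub>M\<^esub> g"
    proof -
      have c: "t \<in> carrier R" "t' \<in> carrier R" using h by auto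
      have "t' \<odot>\<^bsub>M\<^esub> (t \<odot>\<^bsub>M\<^esub> x \<oplus>\<^bsub>M\<^esub> s \<odot>\<^bsub>M\<^esub> g) = (t \<otimes> t') \<odot>\<^bsub>M\<^esub> x \<oplus>\<^bsub>M\<^esub> (t' \<otimes> s) \<odot>\<^bsub>M\<^esub> g"
        using c h(1,3) g by (simp add: smult_r_distr smult_assoc1[symmetric] R.m_comm[of t' t])
      moreover have "t \<odot>\<^bsub>M\<^esub> (t' \<odot>\<^bsub>M\<^esub> y \<oplus>\<^bsub>M\<^esub> s' \<odot>\<^bsub>M\<^esub> g) = (t \<otimes> t') \<odot>\<^bsub>M\<^esub> y \<oplus>\<^bsub>M\<^esub> (t \<otimes> s') \<odot>\<^bsub>M\<^esub> g"
        using c h(5,7) g by (simp add: smult_r_distr smult_assoc1[symmetric])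
      ultimately show ?thesis
        using c h(1,3,5,7) g by (simp add: smult_r_distr smult_l_distr M.a_ac)
    qed
    finally have "(t \<otimes> t') \<odot>\<^bsub>M\<^esub> (x \<oplus>\<^bsub>M\<^esub> y) \<oplus>\<^bsub>M\<^esub> (t' \<otimes> s \<oplus> t \<otimes> s') \<odot>\<^bsub>M\<^esub> g \<in> L" .
    moreover have "t \<otimes> t' \<in> carrier R - p" using h p.I_prime by auto
    moreover have "t' \<otimes> s \<oplus> t \<otimes> s' \<in> carrier R" using h by auto
    moreover have "x \<oplus>\<^bsub>M\<^esub> y \<in> carrier M" using h by auto
    ultimately show ?thesis unfolding saturated_extension_def by blast
  qed
  have smult: "a \<odot>\<^bsub>M\<^esub> x \<in> ?E" if a: "a \<in> carrier R" and "x \<in> ?E" for a x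
  proof -
    from that obtain t s where
      h: "x \<in> carrier M" "t \<in> carrier R - p" "s \<in> carrier R" "t \<odot>\<^bsub>M\<^esub> x \<oplus>\<^bsub>M\<^esub> s \<odot>\<^bsub>M\<^esub> g \<in> L"
      unfolding saturated_extension_def by blast
    have "a \<odot>\<^bsub>M\<^esub> (t \<odot>\<^bsub>M\<^esub> x \<oplus>\<^bsub>M\<^esub> s \<odot>\<^bsub>M\<^esub> g) \<in> L" using h a LE by blast
    also have "a \<odot>\<^bsub>M\<^esub> (t \<odot>\<^bsub>M\<^esub> x \<oplus>\<^bsub>M\<^esub> s \<odot>\<^bsub>M\<^esub> g) = t \<odot>\<^bsub>M\<^esub> (a \<odot>\<^bsub>M\<^esub> x) \<oplus>\<^bsub>M\<^esub> (a \<otimes> s) \<odot>\<^bsub>M\<^esub> g"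
      using h g a by (simp add: smult_r_distr smult_assoc1[symmetric] R.m_comm)
    finally show ?thesis using h a unfolding saturated_extension_def by blast
  qed
  show "submodule ?E R M"
  proof (rule submoduleI)
    show "?E \<subseteq> carrier M" by (auto simp: saturated_extension_def)
    show "\<zero>\<^bsub>M\<^esub> \<in> ?E" using sub zero_L by blast
    show "\<ominus>\<^bsub>M\<^esub> x \<in> ?E" if "x \<in> ?E" for x
    proof -
      have "x \<in> carrier M" using that by (auto simp: saturated_extension_def)
      then show ?thesis using smult[of "\<ominus> \<one>" x] that by (simp add: smult_l_minus)
    qed
  qed (use add smult in auto)
qed

text \<open>
  Among the saturated submodules that miss \<open>w\<close>, one that contains as many of the \<open>g j\<close> as possible
  has a quotient of rank one: every \<open>g j\<close> is, up to a common denominator \<open>t\<close>, a multiple of \<open>w\<close>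
  there, and the multiples define the functional.
\<close>

lemma separating_functional:
  assumes p: "primeideal p R" and L: "submodule L R M" and sat: "saturated p L"
    and pM: "\<And>r x. r \<in> p \<Longrightarrow> x \<in> carrier M \<Longrightarrow> r \<odot>\<^bsub>M\<^esub> x \<in> L"
    and w: "w \<in> carrier M" "w \<notin> L"
    and J: "finite J" and g: "g \<in> J \<rightarrow> carrier M"
  obtains c where "c \<in> J \<rightarrow> carrier R"
    and "\<And>z. z \<in> J \<rightarrow> carrier R \<Longrightarrow> (\<Oplus>\<^bsub>M\<^esub>j\<in>J. z j \<odot>\<^bsub>M\<^esub> g j) \<in> L \<Longrightarrow> (\<Oplus>j\<in>J. z j \<otimes> c j) \<in> p"
    and "\<And>z. z \<in> J \<rightarrow> carrier R \<Longrightarrow> (\<Oplus>\<^bsub>M\<^esub>j\<in>J. z j \<odot>\<^bsub>M\<^esub> g j) = w \<Longrightarrow> (\<Oplus>j\<in>J. z j \<otimes> c j) \<notin> p"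
proof -
  interpret p: primeideal p R by fact
  have one_p: "\<one> \<notin> p" using p.one_imp_carrier p.I_notcarr by blast
  define cand where "cand K \<longleftrightarrow> submodule K R M \<and> saturated p K \<and> L \<subseteq> K \<and> w \<notin> K" for K
  have "cand L" using L sat w by (simp add: cand_def)
  \<comment> \<open>At most all of \<open>J\<close> is counted, so some candidate has the largest
    count. The bound is strict, hence the \<open>Suc\<close>.\<close>
  moreover have "\<forall>K. cand K \<longrightarrow> card {j \<in> J. g j \<in> K} < Suc (card J)"
    using J by (auto simp: less_Suc_eq_le intro: card_mono)
  ultimately obtain K where K: "cand K"
    and max: "\<And>K'. cand K' \<Longrightarrow> card {j \<in> J. g j \<in> K'} \<le> card {j \<in> J. g j \<in> K}"
    using ex_has_greatest_nat[of cand L "\<lambda>K. card {j \<in> J. g j \<in> K}" "Suc (card J)"] by blast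
  have sub: "submodule K R M" and satK: "saturated p K" and "L \<subseteq> K" and wK: "w \<notin> K"
    using K by (auto simp: cand_def)
  note KE = submoduleE[OF sub]
  have cancel: "y \<in> K" if "x \<oplus>\<^bsub>M\<^esub> y \<in> K" "x \<in> K" "y \<in> carrier M" for x y
  proof -
    have x: "x \<in> carrier M" using that KE(1) by blast
    have "(\<ominus>\<^bsub>M\<^esub> x) \<oplus>\<^bsub>M\<^esub> (x \<oplus>\<^bsub>M\<^esub> y) \<in> K" using that KE by blast
    then show ?thesis using x that by (simp add: M.a_assoc[symmetric] M.l_neg)
  qed
  \<comment> \<open>Otherwise saturation would put \<open>w\<close> itself into
    \<open>K\<close>.\<close>
  have zero_w: "r \<in> p" if "r \<in> carrier R" "r \<odot>\<^bsub>M\<^esub> w \<in> K" for r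
    using that satK w wK unfolding saturated_def by blast
  have each: "\<exists>t \<in> carrier R - p. \<exists>s \<in> carrier R. t \<odot>\<^bsub>M\<^esub> g j \<oplus>\<^bsub>M\<^esub> s \<odot>\<^bsub>M\<^esub> w \<in> K" if j: "j \<in> J" for j
  proof (cases "g j \<in> K")
    case True
    then have "\<one> \<odot>\<^bsub>M\<^esub> g j \<oplus>\<^bsub>M\<^esub> \<zero> \<odot>\<^bsub>M\<^esub> w \<in> K" using w KE(1) by (simp add: subset_iff)
    then show ?thesis using one_p by blast
  next
    case False
    have gj: "g j \<in> carrier M" using g j by auto
    let ?E = "saturated_extension p K (g j)"
    note E = submodule_saturated_extension[OF p sub gj] saturated_saturated_extension[OF p sub gj]
      subset_saturated_extension[OF p sub gj] mem_saturated_extension[OF p sub gj]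
    have "{i \<in> J. g i \<in> K} \<subset> {i \<in> J. g i \<in> ?E}" using E(3,4) False j by blast
    then have "card {i \<in> J. g i \<in> K} < card {i \<in> J. g i \<in> ?E}"
      using J by (intro psubset_card_mono) auto
    \<comment> \<open>The extension gains \<open>g j\<close>, so by maximality it is no candidate;
      missing \<open>w\<close> is the only requirement that it can fail.\<close>
    then have "w \<in> ?E" using max[of ?E] E \<open>L \<subseteq> K\<close> unfolding cand_def by fastforce
    then obtain t s where ts: "t \<in> carrier R - p" "s \<in> carrier R" "t \<odot>\<^bsub>M\<^esub> w \<oplus>\<^bsub>M\<^esub> s \<odot>\<^bsub>M\<^esub> g j \<in> K"
      unfolding saturated_extension_def by blast
    \<comment> \<open>The relation between \<open>w\<close> and \<open>g j\<close> is to be reread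
      with \<open>s\<close> as the denominator of \<open>g j\<close>. If \<open>s\<close> were in
      \<open>p\<close>, then \<open>s\<close> times \<open>g j\<close> would lie in
      \<open>L\<close>, which would leave \<open>t\<close> times \<open>w\<close> in
      \<open>K\<close>.\<close>
    have "s \<notin> p"
    proof
      assume "s \<in> p"
      then have "s \<odot>\<^bsub>M\<^esub> g j \<in> K" using pM gj \<open>L \<subseteq> K\<close> by blast
      then have "t \<odot>\<^bsub>M\<^esub> w \<in> K"
        using cancel[of "s \<odot>\<^bsub>M\<^esub> g j" "t \<odot>\<^bsub>M\<^esub> w"] ts w gj by (simp add: M.a_comm)
      then show False using zero_w ts by blast
    qed
    moreover have "s \<odot>\<^bsub>M\<^esub> g j \<oplus>\<^bsub>M\<^esub> t \<odot>\<^bsub>M\<^esub> w \<in> K" using ts w gj by (simp add: M.a_comm)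
    ultimately show ?thesis using ts by blast
  qed
  \<comment> \<open>The product of the individual denominators serves all \<open>g j\<close> at
    once.\<close>
  have "\<exists>t \<in> carrier R - p. \<forall>j\<in>J. \<exists>s \<in> carrier R. t \<odot>\<^bsub>M\<^esub> g j \<oplus>\<^bsub>M\<^esub> s \<odot>\<^bsub>M\<^esub> w \<in> K"
    using J g each
  proof (induction J rule: finite_induct)
    case empty
    then show ?case using one_p by blast
  next
    case (insert j J)
    have mult: "\<exists>s' \<in> carrier R. (r \<otimes> t) \<odot>\<^bsub>M\<^esub> x \<oplus>\<^bsub>M\<^esub> s' \<odot>\<^bsub>M\<^esub> w \<in> K"
      if "r \<in> carrier R" "t \<in> carrier R" "x \<in> carrier M"
        "\<exists>s \<in> carrier R. t \<odot>\<^bsub>M\<^esub> x \<oplus>\<^bsub>M\<^esub> s \<odot>\<^bsub>M\<^esub> w \<in> K" for r t x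
    proof -
      from that obtain s where s: "s \<in> carrier R" "t \<odot>\<^bsub>M\<^esub> x \<oplus>\<^bsub>M\<^esub> s \<odot>\<^bsub>M\<^esub> w \<in> K" by blast
      then have "r \<odot>\<^bsub>M\<^esub> (t \<odot>\<^bsub>M\<^esub> x \<oplus>\<^bsub>M\<^esub> s \<odot>\<^bsub>M\<^esub> w) \<in> K" using KE that by blast
      then have "(r \<otimes> t) \<odot>\<^bsub>M\<^esub> x \<oplus>\<^bsub>M\<^esub> (r \<otimes> s) \<odot>\<^bsub>M\<^esub> w \<in> K"
        using that s w by (simp add: smult_r_distr smult_assoc1)
      then show ?thesis using that s by blast
    qed
    from insert obtain t where t: "t \<in> carrier R - p"
      "\<forall>i\<in>J. \<exists>s \<in> carrier R. t \<odot>\<^bsub>M\<^esub> g i \<oplus>\<^bsub>M\<^esub> s \<odot>\<^bsub>M\<^esub> w \<in> K" by auto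
    from insert.prems obtain t' where t': "t' \<in> carrier R - p"
      "\<exists>s \<in> carrier R. t' \<odot>\<^bsub>M\<^esub> g j \<oplus>\<^bsub>M\<^esub> s \<odot>\<^bsub>M\<^esub> w \<in> K" by blast
    have "\<exists>s \<in> carrier R. (t' \<otimes> t) \<odot>\<^bsub>M\<^esub> g i \<oplus>\<^bsub>M\<^esub> s \<odot>\<^bsub>M\<^esub> w \<in> K" if "i \<in> J" for i
      using mult[of t' t "g i"] that t t' insert.prems(1) by auto
    moreover have "\<exists>s \<in> carrier R. (t' \<otimes> t) \<odot>\<^bsub>M\<^esub> g j \<oplus>\<^bsub>M\<^esub> s \<odot>\<^bsub>M\<^esub> w \<in> K"
      using mult[of t t' "g j"] t t' insert.prems(1) by (auto simp: R.m_comm)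
    moreover have "t' \<otimes> t \<in> carrier R - p" using t t' p.I_prime by auto
    ultimately show ?case by blast
  qed
  then obtain t where t: "t \<in> carrier R" "t \<notin> p"
    "\<forall>j\<in>J. \<exists>s. s \<in> carrier R \<and> t \<odot>\<^bsub>M\<^esub> g j \<oplus>\<^bsub>M\<^esub> s \<odot>\<^bsub>M\<^esub> w \<in> K" by blast
  from bchoice[OF t(3)] obtain c where
    c: "\<And>j. j \<in> J \<Longrightarrow> c j \<in> carrier R" "\<And>j. j \<in> J \<Longrightarrow> t \<odot>\<^bsub>M\<^esub> g j \<oplus>\<^bsub>M\<^esub> c j \<odot>\<^bsub>M\<^esub> w \<in> K"
    by blast
  \<comment> \<open>Modulo \<open>K\<close>, \<open>t\<close> times a combination of the
    \<open>g j\<close> is minus the value of the functional times \<open>w\<close>. Both required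
    properties are read off from this relation.\<close>
  have key: "t \<odot>\<^bsub>M\<^esub> (\<Oplus>\<^bsub>M\<^esub>j\<in>J. z j \<odot>\<^bsub>M\<^esub> g j) \<oplus>\<^bsub>M\<^esub> (\<Oplus>j\<in>J. z j \<otimes> c j) \<odot>\<^bsub>M\<^esub> w \<in> K"
    if z: "z \<in> J \<rightarrow> carrier R" for z
  proof -
    have "t \<odot>\<^bsub>M\<^esub> (\<Oplus>\<^bsub>M\<^esub>j\<in>J. z j \<odot>\<^bsub>M\<^esub> g j) \<oplus>\<^bsub>M\<^esub> (\<Oplus>j\<in>J. z j \<otimes> c j) \<odot>\<^bsub>M\<^esub> w =
      (\<Oplus>\<^bsub>M\<^esub>j\<in>J. z j \<odot>\<^bsub>M\<^esub> (t \<odot>\<^bsub>M\<^esub> g j \<oplus>\<^bsub>M\<^esub> c j \<odot>\<^bsub>M\<^esub> w))"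
      using J g c(1) z
    proof (induction J rule: finite_induct)
      case empty
      then show ?case using t w by simp
    next
      case (insert j J)
      let ?S = "\<Oplus>\<^bsub>M\<^esub>j\<in>J. z j \<odot>\<^bsub>M\<^esub> g j" and ?s = "\<Oplus>j\<in>J. z j \<otimes> c j"
      have cl: "?S \<in> carrier M" "?s \<in> carrier R" "g j \<in> carrier M" "c j \<in> carrier R" "z j \<in> carrier R"
        using insert.prems by (auto intro!: M.finsum_closed R.finsum_closed simp: Pi_iff)
      have "(\<Oplus>\<^bsub>M\<^esub>j\<in>insert j J. z j \<odot>\<^bsub>M\<^esub> g j) = z j \<odot>\<^bsub>M\<^esub> g j \<oplus>\<^bsub>M\<^esub> ?S"
        "(\<Oplus>j\<in>insert j J. z j \<otimes> c j) = z j \<otimes> c j \<oplus> ?s"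
        "(\<Oplus>\<^bsub>M\<^esub>j\<in>insert j J. z j \<odot>\<^bsub>M\<^esub> (t \<odot>\<^bsub>M\<^esub> g j \<oplus>\<^bsub>M\<^esub> c j \<odot>\<^bsub>M\<^esub> w)) =
          z j \<odot>\<^bsub>M\<^esub> (t \<odot>\<^bsub>M\<^esub> g j \<oplus>\<^bsub>M\<^esub> c j \<odot>\<^bsub>M\<^esub> w) \<oplus>\<^bsub>M\<^esub> (\<Oplus>\<^bsub>M\<^esub>j\<in>J. z j \<odot>\<^bsub>M\<^esub> (t \<odot>\<^bsub>M\<^esub> g j \<oplus>\<^bsub>M\<^esub> c j \<odot>\<^bsub>M\<^esub> w))"
        using insert.hyps insert.prems t w by (auto intro!: M.finsum_insert R.finsum_insert simp: Pi_iff)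
      moreover have "(\<Oplus>\<^bsub>M\<^esub>j\<in>J. z j \<odot>\<^bsub>M\<^esub> (t \<odot>\<^bsub>M\<^esub> g j \<oplus>\<^bsub>M\<^esub> c j \<odot>\<^bsub>M\<^esub> w)) = t \<odot>\<^bsub>M\<^esub> ?S \<oplus>\<^bsub>M\<^esub> ?s \<odot>\<^bsub>M\<^esub> w"
        using insert by auto
      ultimately show ?case using cl t w
        by (simp add: smult_r_distr smult_l_distr smult_assoc1[symmetric] R.m_comm[of t "z j"] M.a_ac)
    qed
    also have "\<dots> \<in> K" using c z by (intro finsum_mem_submodule[OF sub J] KE(4)) auto
    finally show ?thesis .
  qed
  have cl: "(\<Oplus>\<^bsub>M\<^esub>j\<in>J. z j \<odot>\<^bsub>M\<^esub> g j) \<in> carrier M" "(\<Oplus>j\<in>J. z j \<otimes> c j) \<in> carrier R"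
    if "z \<in> J \<rightarrow> carrier R" for z
    using that g c by (auto intro!: M.finsum_closed R.finsum_closed simp: Pi_iff)
  show thesis
  proof (rule that[of c])
    show "c \<in> J \<rightarrow> carrier R" using c by blast
  next
    fix z assume z: "z \<in> J \<rightarrow> carrier R" and "(\<Oplus>\<^bsub>M\<^esub>j\<in>J. z j \<odot>\<^bsub>M\<^esub> g j) \<in> L"
    then have "t \<odot>\<^bsub>M\<^esub> (\<Oplus>\<^bsub>M\<^esub>j\<in>J. z j \<odot>\<^bsub>M\<^esub> g j) \<in> K" using KE(4) t \<open>L \<subseteq> K\<close> by blast
    then show "(\<Oplus>j\<in>J. z j \<otimes> c j) \<in> p" using cancel[OF key[OF z]] cl[OF z] w zero_w by simp
  next
    fix z assume z: "z \<in> J \<rightarrow> carrier R" and "(\<Oplus>\<^bsub>M\<^esub>j\<in>J. z j \<odot>\<^bsub>M\<^esub> g j) = w"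
    \<comment> \<open>So the functional takes the value \<open>\<ominus> t\<close> at
      \<open>w\<close> modulo \<open>p\<close>, and \<open>t\<close> is outside
      \<open>p\<close>.\<close>
    then have "(t \<oplus> (\<Oplus>j\<in>J. z j \<otimes> c j)) \<odot>\<^bsub>M\<^esub> w \<in> K"
      using key[OF z] t w cl[OF z] by (simp add: smult_l_distr)
    then have *: "t \<oplus> (\<Oplus>j\<in>J. z j \<otimes> c j) \<in> p" using zero_w t cl[OF z] by simp
    show "(\<Oplus>j\<in>J. z j \<otimes> c j) \<notin> p"
    proof
      assume "(\<Oplus>j\<in>J. z j \<otimes> c j) \<in> p"
      then have "(t \<oplus> (\<Oplus>j\<in>J. z j \<otimes> c j)) \<oplus> (\<ominus> (\<Oplus>j\<in>J. z j \<otimes> c j)) \<in> p"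
        using * p.a_closed p.a_inv_closed by blast
      then show False using t cl[OF z] by (simp add: R.a_assoc R.r_neg)
    qed
  qed
qed

end

section \<open>Coordinate functions on central division algebras\<close>

text \<open>The action on \<open>A\<close> of the element \<open>\<Sum>s. e s \<otimes> b s\<close>
  of the tensor product of \<open>A\<close> with its opposite ring.\<close>

definition sandwich :: "('a, 'b) ring_scheme \<Rightarrow> nat \<Rightarrow> (nat \<Rightarrow> 'a) \<Rightarrow> (nat \<Rightarrow> 'a) \<Rightarrow> 'a \<Rightarrow> 'a" where
  "sandwich A k e b x = (\<Oplus>\<^bsub>A\<^esub>s\<in>{..<k}. e s \<otimes>\<^bsub>A\<^esub> x \<otimes>\<^bsub>A\<^esub> b s)"

text \<open>\<open>e\<close> is a basis of \<open>A\<close> over its centre, and row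
  \<open>j\<close> of \<open>\<beta>\<close> gives the \<open>j\<close>-th coordinate function, with
  the basis itself as left factors. Coordinates expressed by two-sided products carry over to a
  tensor product, where division is no longer available.\<close>

locale sandwich_basis = ring A for A (structure) +
  fixes k :: nat and e :: "nat \<Rightarrow> 'a" and \<beta> :: "nat \<Rightarrow> nat \<Rightarrow> 'a"
  assumes e_closed [simp]: "s < k \<Longrightarrow> e s \<in> carrier A"
    and beta_closed [simp]: "j < k \<Longrightarrow> s < k \<Longrightarrow> \<beta> j s \<in> carrier A"
    and coord_central: "j < k \<Longrightarrow> x \<in> carrier A \<Longrightarrow> sandwich A k e (\<beta> j) x \<in> ring_center A"
    and coord_e: "j < k \<Longrightarrow> s < k \<Longrightarrow> sandwich A k e (\<beta> j) (e s) = (if s = j then \<one> else \<zero>)"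
    and expansion: "x \<in> carrier A \<Longrightarrow> (\<Oplus>j\<in>{..<k}. sandwich A k e (\<beta> j) x \<otimes> e j) = x"

section \<open>The centre and the operators built from two-sided multiplications\<close>

lemma ring_centerD: "z \<in> ring_center A \<Longrightarrow> z \<in> carrier A"
  "z \<in> ring_center A \<Longrightarrow> x \<in> carrier A \<Longrightarrow> z \<otimes>\<^bsub>A\<^esub> x = x \<otimes>\<^bsub>A\<^esub> z"
  by (auto simp: ring_center_def)

context ring
begin

lemma finsum_lessThan_Suc_shift:
  "f \<in> {..<Suc n} \<rightarrow> carrier R \<Longrightarrow>
    (\<Oplus>i\<in>{..<Suc n}. f i) = f 0 \<oplus> (\<Oplus>i\<in>{..<n}. f (Suc i))" for n :: nat
  unfolding lessThan_Suc_eq_insert_0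
  by (subst finsum_insert) (auto simp: Pi_iff finsum_reindex)

lemma subcring_ring_center: "subcring (ring_center R) R"
proof (intro subcringI subringI)
  show "ring_center R \<subseteq> carrier R" by (auto simp: ring_center_def)
  show "\<one> \<in> ring_center R" by (simp add: ring_center_def)
  show "\<ominus> h \<in> ring_center R" if "h \<in> ring_center R" for h
    using that by (simp add: ring_center_def l_minus r_minus)
  show "h \<oplus> g \<in> ring_center R" if "h \<in> ring_center R" "g \<in> ring_center R" for h g
    using that by (simp add: ring_center_def l_distr r_distr)
  show "h \<otimes> g \<in> ring_center R" if h: "h \<in> ring_center R" and g: "g \<in> ring_center R" for h g
  proof -
    note c = ring_centerD(1)[OF h] ring_centerD(1)[OF g]
    have "h \<otimes> g \<otimes> x = x \<otimes> (h \<otimes> g)" if x: "x \<in> carrier R" for x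
    proof -
      have "h \<otimes> g \<otimes> x = h \<otimes> x \<otimes> g" using c x ring_centerD(2)[OF g x] by (simp add: m_assoc)
      also have "\<dots> = x \<otimes> (h \<otimes> g)" using c x ring_centerD(2)[OF h x] by (simp add: m_assoc)
      finally show ?thesis .
    qed
    then show ?thesis using c by (simp add: ring_center_def)
  qed
  show "h \<otimes> g = g \<otimes> h" if "h \<in> ring_center R" "g \<in> ring_center R" for h g
    using ring_centerD that by metis
qed

text \<open>The multiplication algebra of the ring. Only values on the carrier count, hence the
  pointwise hypotheses.\<close>

inductive two_sided_op :: "('a \<Rightarrow> 'a) \<Rightarrow> bool" where
  single: "\<lbrakk>a \<in> carrier R; b \<in> carrier R; \<And>x. x \<in> carrier R \<Longrightarrow> T x = a \<otimes> x \<otimes> b\<rbrakk> \<Longrightarrow> two_sided_op T"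
| add: "\<lbrakk>two_sided_op S; two_sided_op T; \<And>x. x \<in> carrier R \<Longrightarrow> U x = S x \<oplus> T x\<rbrakk> \<Longrightarrow> two_sided_op U"

lemma two_sided_op_closed [simp]: "two_sided_op T \<Longrightarrow> x \<in> carrier R \<Longrightarrow> T x \<in> carrier R"
  by (induction rule: two_sided_op.induct) auto

lemma two_sided_op_add:
  "two_sided_op T \<Longrightarrow> x \<in> carrier R \<Longrightarrow> y \<in> carrier R \<Longrightarrow> T (x \<oplus> y) = T x \<oplus> T y"
  by (induction rule: two_sided_op.induct) (simp_all add: l_distr r_distr a_ac)

lemma two_sided_op_central:
  assumes "two_sided_op T" "z \<in> ring_center R" "x \<in> carrier R"
  shows "T (z \<otimes> x) = z \<otimes> T x"
  using assms(1)
proof (induction rule: two_sided_op.induct)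
  case (single a b T)
  then show ?case
    using ring_centerD(1)[OF assms(2)] ring_centerD(2)[OF assms(2) single(1)] assms(3)
    by (simp flip: m_assoc)
qed (use ring_centerD[OF assms(2)] assms(3) in \<open>simp add: r_distr\<close>)

lemma two_sided_op_lmult:
  assumes "two_sided_op T" "a \<in> carrier R"
  shows "two_sided_op (\<lambda>x. a \<otimes> T x)"
  using assms(1)
proof (induction rule: two_sided_op.induct)
  case (single c b T)
  then show ?case using assms(2) by (intro two_sided_op.single[of "a \<otimes> c" b]) (auto simp: m_assoc)
next
  case (add S T U)
  then show ?case using assms(2) by (intro two_sided_op.add[OF add.IH]) (auto simp: r_distr)
qed

lemma two_sided_op_rmult:
  assumes "two_sided_op T" "a \<in> carrier R"
  shows "two_sided_op (\<lambda>x. T x \<otimes> a)"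
  using assms(1)
proof (induction rule: two_sided_op.induct)
  case (single c b T)
  then show ?case using assms(2) by (intro two_sided_op.single[of c "b \<otimes> a"]) (auto simp: m_assoc)
next
  case (add S T U)
  then show ?case using assms(2) by (intro two_sided_op.add[OF add.IH]) (auto simp: l_distr)
qed

lemma two_sided_op_diff:
  assumes "two_sided_op S" "two_sided_op T"
  shows "two_sided_op (\<lambda>x. S x \<ominus> T x)"
  using assms
  by (intro two_sided_op.add[OF assms(1) two_sided_op_lmult[OF assms(2), of "\<ominus> \<one>"]])
    (auto simp: l_minus minus_eq)

text \<open>A left factor \<open>a\<close> is expanded over the spanning family \<open>e\<close>,
  and its central coefficients \<open>c s\<close> are moved past \<open>e s \<otimes> x\<close> into
  the right factor. Thus one family of left factors serves all operators.\<close>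

lemma two_sided_op_representation:
  assumes "two_sided_op T" and e: "e \<in> {..<k} \<rightarrow> carrier R"
    and span: "\<And>x. x \<in> carrier R \<Longrightarrow> \<exists>c \<in> {..<k} \<rightarrow> ring_center R. x = (\<Oplus>s\<in>{..<k}. c s \<otimes> e s)"
  shows "\<exists>b \<in> {..<k} \<rightarrow> carrier R. \<forall>x \<in> carrier R. T x = sandwich R k e b x"
  using assms(1)
proof (induction rule: two_sided_op.induct)
  case (single a b T)
  then obtain c where c: "c \<in> {..<k} \<rightarrow> ring_center R" "a = (\<Oplus>s\<in>{..<k}. c s \<otimes> e s)"
    using span by blast
  have cc: "c s \<in> carrier R" "e s \<in> carrier R" if "s < k" for s
    using that c(1) e ring_centerD(1)[of "c s" R] by auto
  have "T x = sandwich R k e (\<lambda>s. c s \<otimes> b) x" if x: "x \<in> carrier R" for x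
  proof -
    have "T x = (\<Oplus>s\<in>{..<k}. c s \<otimes> e s \<otimes> x \<otimes> b)"
      using single x c(2) cc by (simp add: finsum_ldistr Pi_iff)
    also have "\<dots> = (\<Oplus>s\<in>{..<k}. e s \<otimes> x \<otimes> (c s \<otimes> b))"
    proof (intro finsum_cong' refl)
      fix s assume "s \<in> {..<k}"
      then have "c s \<in> ring_center R" "c s \<in> carrier R" "e s \<in> carrier R" using c cc by auto
      then show "c s \<otimes> e s \<otimes> x \<otimes> b = e s \<otimes> x \<otimes> (c s \<otimes> b)"
        using ring_centerD(2)[of "c s" R "e s \<otimes> x"] x single.hyps by (simp add: m_assoc[symmetric])
    qed (use cc x single.hyps in auto)
    finally show ?thesis by (simp add: sandwich_def)
  qed
  then show ?case using cc single.hyps by (intro bexI[of _ "\<lambda>s. c s \<otimes> b"]) auto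
next
  case (add S T U)
  from add.IH obtain b b' where b: "b \<in> {..<k} \<rightarrow> carrier R" "b' \<in> {..<k} \<rightarrow> carrier R"
    "\<And>x. x \<in> carrier R \<Longrightarrow> S x = sandwich R k e b x" "\<And>x. x \<in> carrier R \<Longrightarrow> T x = sandwich R k e b' x"
    by blast
  have "U x = sandwich R k e (\<lambda>s. b s \<oplus> b' s) x" if "x \<in> carrier R" for x
  proof -
    have "U x = (\<Oplus>s\<in>{..<k}. e s \<otimes> x \<otimes> b s \<oplus> e s \<otimes> x \<otimes> b' s)"
      using b e that add.hyps by (subst finsum_addf) (auto simp: sandwich_def Pi_iff)
    also have "\<dots> = sandwich R k e (\<lambda>s. b s \<oplus> b' s) x"
      unfolding sandwich_def using b e that by (intro finsum_cong') (auto simp: Pi_iff r_distr)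
    finally show ?thesis .
  qed
  then show ?case using b by (intro bexI[of _ "\<lambda>s. b s \<oplus> b' s"]) auto
qed

end

section \<open>Division rings of finite dimension over their centre\<close>

locale skew_field = ring +
  assumes zero_neq_one: "\<zero> \<noteq> \<one>"
    and division: "Units R = carrier R - {\<zero>}"
begin

lemma subfield_ring_center: "subfield (ring_center R) R"
proof (rule subfieldI[OF subcring_ring_center])
  have "z \<in> Units (R\<lparr>carrier := ring_center R\<rparr>)" if z: "z \<in> ring_center R" "z \<noteq> \<zero>" for z
  proof -
    have zu: "z \<in> Units R" using z ring_centerD(1)[OF z(1)] division by simp
    have "inv z \<otimes> x = x \<otimes> inv z" if x: "x \<in> carrier R" for x
    proof -
      have "inv z \<otimes> x = inv z \<otimes> (x \<otimes> z) \<otimes> inv z" using zu x z(1) by (simp add: m_assoc ring_centerD(1))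
      also have "\<dots> = inv z \<otimes> (z \<otimes> x) \<otimes> inv z" using ring_centerD(2)[OF z(1) x] by simp
      also have "\<dots> = x \<otimes> inv z" using zu x z(1) by (simp add: ring_centerD(1) flip: m_assoc)
      finally show ?thesis .
    qed
    then have "inv z \<in> ring_center R" using zu by (simp add: ring_center_def)
    moreover have "inv z \<otimes> z = \<one>" "z \<otimes> inv z = \<one>" using zu by simp_all
    ultimately show ?thesis using z by (auto simp: Units_def)
  qed
  moreover have "\<zero> \<notin> Units (R\<lparr>carrier := ring_center R\<rparr>)"
    using zero_neq_one ring_centerD(1)[of _ R] by (auto simp: Units_def)
  ultimately show "Units (R\<lparr>carrier := ring_center R\<rparr>) = ring_center R - {\<zero>}"
    by (auto simp: Units_def)
qed

text \<open>
  The Artin--Whaples argument: if \<open>T y\<close> is not central, then some commutator of \<open>T\<close> with a ring element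
  vanishes at \<open>v\<close> and on \<open>Us\<close> but not at \<open>y\<close>; if it is central, the induction hypothesis is applied to
  \<open>y - T y * v\<close>.
\<close>

lemma two_sided_op_separation:
  assumes "set Us \<subseteq> carrier R" "v \<in> carrier R" "v \<notin> Span (ring_center R) Us"
  shows "\<exists>T. two_sided_op T \<and> T v = \<one> \<and> (\<forall>x \<in> Span (ring_center R) Us. T x = \<zero>)"
  using assms
proof (induction Us arbitrary: v)
  case Nil
  then have "v \<in> Units R" using division by simp
  moreover from this have "two_sided_op (\<lambda>x. inv v \<otimes> x)"
    by (intro two_sided_op.single[of "inv v" \<one>]) auto
  ultimately show ?case by (intro exI[of _ "\<lambda>x. inv v \<otimes> x"]) simp
next
  case (Cons y Us)
  let ?K = "ring_center R"
  note K = subfield_ring_center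
  have y: "y \<in> carrier R" and Us: "set Us \<subseteq> carrier R" using Cons.prems by auto
  have span: "x \<in> Span ?K (y # Us) \<longleftrightarrow> (\<exists>c\<in>?K. \<exists>u\<in>Span ?K Us. x = c \<otimes> y \<oplus> u)" for x
    by (simp add: line_extension_mem_iff)
  have Span_sub: "Span ?K Us \<subseteq> carrier R" using Span_in_carrier[OF subcring.axioms(1)[OF subcring_ring_center, THEN subringE(1)] Us] .
  have "v \<notin> Span ?K Us"
  proof
    assume "v \<in> Span ?K Us"
    then have "v \<in> Span ?K (y # Us)"
      using y Span_sub subringE(2)[OF subcring.axioms(1)[OF subcring_ring_center]] Cons.prems(2)
      unfolding span by (intro bexI[of _ "\<zero>"] bexI[of _ v]) auto
    then show False using Cons.prems(3) by blast
  qed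
  then obtain T where T: "two_sided_op T" "T v = \<one>" "\<And>x. x \<in> Span ?K Us \<Longrightarrow> T x = \<zero>"
    using Cons.IH[OF Us Cons.prems(2)] by blast
  \<comment> \<open>Operators are linear over the centre, so vanishing at \<open>y\<close> and on
    the span of \<open>Us\<close> gives vanishing on the span of \<open>y # Us\<close>.\<close>
  have enough: ?case if "two_sided_op S" "S v = \<one>" "S y = \<zero>" "\<And>x. x \<in> Span ?K Us \<Longrightarrow> S x = \<zero>" for S
  proof (intro exI[of _ S] conjI ballI)
    fix x assume "x \<in> Span ?K (y # Us)"
    then obtain c u where "c \<in> ?K" "u \<in> Span ?K Us" "x = c \<otimes> y \<oplus> u" unfolding span by blast
    moreover have "c \<in> carrier R" "u \<in> carrier R"
      using calculation ring_centerD(1)[of c R] Span_sub by auto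
    ultimately show "S x = \<zero>"
      using that y by (simp add: two_sided_op_add two_sided_op_central)
  qed (fact that)+
  show ?case
  proof (cases "T y = \<zero>")
    case True
    then show ?thesis using enough T by blast
  next
    case False
    have Ty: "T y \<in> carrier R" using T y by simp
    \<comment> \<open>Such an \<open>S\<close> corrects \<open>T\<close>: subtracting
      \<open>T y \<otimes> S x\<close> removes the value at \<open>y\<close> and keeps the value
      \<open>\<one>\<close> at \<open>v\<close>.\<close>
    have "\<exists>S. two_sided_op S \<and> S v = \<zero> \<and> S y = \<one> \<and> (\<forall>x \<in> Span ?K Us. S x = \<zero>)"
    proof (cases "T y \<in> ?K")
      case False
      then obtain a where a: "a \<in> carrier R" "T y \<otimes> a \<noteq> a \<otimes> T y"
        using Ty by (auto simp: ring_center_def)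
      \<comment> \<open>This commutator is nonzero by the choice of \<open>a\<close>, hence
        invertible. The commutator of \<open>a\<close> with \<open>T v\<close> vanishes because
        \<open>T v = \<one>\<close>.\<close>
      let ?d = "a \<otimes> T y \<ominus> T y \<otimes> a"
      have d: "?d \<in> Units R" using a Ty division by (auto simp: r_right_minus_eq)
      let ?S = "\<lambda>x. inv ?d \<otimes> (a \<otimes> T x \<ominus> T x \<otimes> a)"
      have "two_sided_op ?S"
        using d a T by (intro two_sided_op_lmult two_sided_op_diff two_sided_op_rmult) auto
      moreover have "?S v = \<zero>" "\<And>x. x \<in> Span ?K Us \<Longrightarrow> ?S x = \<zero>"
        using T a d by (auto simp: minus_eq r_neg)
      moreover have "?S y = \<one>" using d by simp
      ultimately show ?thesis by blast
    next
      case True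
      have u: "T y \<in> Units R" using False Ty division by simp
      have "inv (T y) \<in> ?K" and "\<ominus> (inv (T y)) \<in> ?K"
        using subfield_m_inv(1)[OF K] True False subringE(5)[OF subcring.axioms(1)[OF subcring_ring_center]] by auto
      let ?y = "y \<ominus> T y \<otimes> v"
      have v: "v \<in> carrier R" by fact
      \<comment> \<open>\<open>T y\<close> is central and invertible, so otherwise \<open>v\<close>
        would be a combination of \<open>y\<close> and \<open>Us\<close>.\<close>
      have "?y \<notin> Span ?K Us"
      proof
        assume h: "?y \<in> Span ?K Us"
        then have "(\<ominus> (inv (T y))) \<otimes> ?y \<in> Span ?K Us"
          using Span_smult_closed[OF K Us \<open>\<ominus> (inv (T y)) \<in> ?K\<close>] by blast
        moreover have "v = inv (T y) \<otimes> y \<oplus> (\<ominus> (inv (T y))) \<otimes> ?y"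
        proof -
          have "(\<ominus> (inv (T y))) \<otimes> ?y = v \<ominus> (inv (T y)) \<otimes> y"
            using u v y Ty by (simp add: minus_eq r_distr l_minus r_minus m_assoc[symmetric] minus_add a_comm)
          then show ?thesis using u v y by (simp add: minus_eq a_lcomm r_neg)
        qed
        ultimately show False using Cons.prems(3) \<open>inv (T y) \<in> ?K\<close> unfolding span by blast
      qed
      then obtain U where U: "two_sided_op U" "U ?y = \<one>" "\<And>x. x \<in> Span ?K Us \<Longrightarrow> U x = \<zero>"
        using Cons.IH[OF Us, of ?y] y v Ty by auto
      \<comment> \<open>Since \<open>T v = \<one>\<close>, the subtraction forces the value zero at
        \<open>v\<close>. At \<open>y\<close> it leaves
        \<open>U y \<ominus> U v \<otimes> T y\<close>, which is \<open>U ?y\<close> because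
        \<open>T y\<close> is central.\<close>
      let ?S = "\<lambda>x. U x \<ominus> U v \<otimes> T x"
      have Uv: "U v \<in> carrier R" "U y \<in> carrier R" using U v y by auto
      have "two_sided_op ?S" using U T Uv by (intro two_sided_op_lmult two_sided_op_diff)
      moreover have "?S v = \<zero>" "\<And>x. x \<in> Span ?K Us \<Longrightarrow> ?S x = \<zero>"
        using T U Uv by (auto simp: minus_eq r_neg)
      moreover have "?S y = \<one>"
      proof -
        have nT: "\<ominus> T y \<in> ?K" using True subringE(5)[OF subcring.axioms(1)[OF subcring_ring_center]] by blast
        have "?y = y \<oplus> (\<ominus> T y) \<otimes> v" using Ty v by (simp add: minus_eq l_minus)
        then have "\<one> = U y \<oplus> (\<ominus> T y) \<otimes> U v"
          using U(1,2) y v Ty nT two_sided_op_add[of U y "(\<ominus> T y) \<otimes> v"] two_sided_op_central[of U "\<ominus> T y" v] by simp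
        also have "\<dots> = ?S y" using Ty Uv ring_centerD(2)[OF True Uv(1)] by (simp add: minus_eq l_minus)
        finally show ?thesis by simp
      qed
      ultimately show ?thesis by blast
    qed
    then obtain S where S: "two_sided_op S" "S v = \<zero>" "S y = \<one>" "\<And>x. x \<in> Span ?K Us \<Longrightarrow> S x = \<zero>"
      by blast
    show ?thesis
      using S T Ty
      by (intro enough[of "\<lambda>x. T x \<ominus> T y \<otimes> S x"] two_sided_op_diff two_sided_op_lmult)
        (auto simp: minus_eq r_neg)
  qed
qed

text \<open>A dual family grows with the independent list: separation provides the coordinate of the
  new vector, and the old coordinates are corrected to vanish there. Central values are claimed on
  the span only, where the operators are the coordinates.\<close>

lemma exists_coordinate_ops:
  assumes "independent (ring_center R) Us"
  shows "\<exists>T. (\<forall>j<length Us. two_sided_op (T j) \<and> (\<forall>x \<in> Span (ring_center R) Us. T j x \<in> ring_center R) \<and>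
      (\<forall>i<length Us. T j (Us ! i) = (if i = j then \<one> else \<zero>))) \<and>
    (\<forall>x \<in> Span (ring_center R) Us. (\<Oplus>j\<in>{..<length Us}. T j x \<otimes> Us ! j) = x)"
  using assms
proof (induction "ring_center R" Us rule: independent.induct)
  case li_Nil
  then show ?case by simp
next
  case (li_Cons u Us)
  let ?K = "ring_center R"
  note K = subfield_ring_center
  have Us: "set Us \<subseteq> carrier R" using independent_in_carrier[OF li_Cons.hyps(3)] .
  have nth: "Us ! i \<in> Span ?K Us" "Us ! i \<in> carrier R" if "i < length Us" for i
    using that Us Span_base_incl[OF K Us] by auto
  have Span_sub: "Span ?K Us \<subseteq> carrier R"
    using Span_in_carrier[OF subcring.axioms(1)[OF subcring_ring_center, THEN subringE(1)] Us] .
  from two_sided_op_separation[OF Us li_Cons.hyps(1,2)] obtain S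
    where S: "two_sided_op S" "S u = \<one>" "\<And>x. x \<in> Span ?K Us \<Longrightarrow> S x = \<zero>" by blast
  from li_Cons.hyps(4) obtain T where T: "\<And>j. j < length Us \<Longrightarrow> two_sided_op (T j)"
    "\<And>j x. j < length Us \<Longrightarrow> x \<in> Span ?K Us \<Longrightarrow> T j x \<in> ?K"
    "\<And>j i. j < length Us \<Longrightarrow> i < length Us \<Longrightarrow> T j (Us ! i) = (if i = j then \<one> else \<zero>)"
    "\<And>x. x \<in> Span ?K Us \<Longrightarrow> (\<Oplus>j\<in>{..<length Us}. T j x \<otimes> Us ! j) = x" by blast
  define T' where "T' j = (case j of 0 \<Rightarrow> S | Suc i \<Rightarrow> \<lambda>x. T i x \<ominus> T i u \<otimes> S x)" for j
  have op: "two_sided_op (T' j)" if "j < length (u # Us)" for j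
    using that S T(1) li_Cons.hyps(1)
    by (auto simp: T'_def split: nat.split intro!: two_sided_op_diff two_sided_op_lmult)
  \<comment> \<open>As \<open>c\<close> is central, the contribution
    \<open>c \<otimes> T i u\<close> of the new vector cancels against the correction
    \<open>T i u \<otimes> c\<close>.\<close>
  have T'_x: "T' 0 x = c \<and> (\<forall>i<length Us. T' (Suc i) x = T i y)"
    if c: "c \<in> ?K" and y: "y \<in> Span ?K Us" and x: "x = c \<otimes> u \<oplus> y" for c y x
  proof -
    have cl: "c \<in> carrier R" "y \<in> carrier R" "u \<in> carrier R"
      using ring_centerD(1)[OF c] y Span_sub li_Cons.hyps(1) by auto
    have 0: "S x = c" using S c y cl by (simp add: x two_sided_op_add two_sided_op_central)
    have "T' (Suc i) x = T i y" if i: "i < length Us" for i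
    proof -
      have Ti: "T i u \<in> carrier R" "T i y \<in> carrier R" using T(1)[OF i] cl by auto
      have "T' (Suc i) x = c \<otimes> T i u \<oplus> T i y \<ominus> T i u \<otimes> c"
        using T(1)[OF i] cl c by (simp add: T'_def 0) (simp add: x two_sided_op_add two_sided_op_central)
      also have "\<dots> = T i y"
        using Ti cl ring_centerD(2)[OF c Ti(1)] by (simp add: minus_eq a_ac r_neg)
      finally show ?thesis .
    qed
    then show ?thesis using 0 by (simp add: T'_def)
  qed
  have span: "x \<in> Span ?K (u # Us) \<longleftrightarrow> (\<exists>c\<in>?K. \<exists>y\<in>Span ?K Us. x = c \<otimes> u \<oplus> y)" for x
    by (simp add: line_extension_mem_iff)
  show ?case
  proof (intro exI[of _ T'] conjI allI impI ballI)
    fix j x assume j: "j < length (u # Us)" and "x \<in> Span ?K (u # Us)"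
    then obtain c y where "c \<in> ?K" "y \<in> Span ?K Us" "x = c \<otimes> u \<oplus> y" unfolding span by blast
    then show "T' j x \<in> ?K" using T'_x[of c y x] T(2) j by (cases j) auto
  next
    fix j i assume j: "j < length (u # Us)" and i: "i < length (u # Us)"
    show "T' j ((u # Us) ! i) = (if i = j then \<one> else \<zero>)"
    proof (cases i)
      case 0
      then show ?thesis
        using S T(1) j li_Cons.hyps(1) by (cases j) (auto simp: T'_def minus_eq r_neg)
    next
      case (Suc l)
      then show ?thesis
        using S(3)[OF nth(1)] T(1)[THEN two_sided_op_closed, OF _ li_Cons.hyps(1)] T(3) i j
        by (cases j) (auto simp: T'_def minus_eq)
    qed
  next
    fix x assume "x \<in> Span ?K (u # Us)"
    then obtain c y where cy: "c \<in> ?K" "y \<in> Span ?K Us" "x = c \<otimes> u \<oplus> y" unfolding span by blast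
    have cl: "c \<in> carrier R" "y \<in> carrier R" "x \<in> carrier R"
      using ring_centerD(1)[OF cy(1)] cy Span_sub li_Cons.hyps(1) by auto
    have "(\<Oplus>j\<in>{..<length (u # Us)}. T' j x \<otimes> (u # Us) ! j) =
        T' 0 x \<otimes> u \<oplus> (\<Oplus>j\<in>{..<length Us}. T' (Suc j) x \<otimes> Us ! j)"
      unfolding length_Cons using op[THEN two_sided_op_closed, OF _ cl(3)] li_Cons.hyps(1) nth(2)
      by (subst finsum_lessThan_Suc_shift) (auto simp: nth_Cons split: nat.split)
    also have "(\<Oplus>j\<in>{..<length Us}. T' (Suc j) x \<otimes> Us ! j) = (\<Oplus>j\<in>{..<length Us}. T j y \<otimes> Us ! j)"
      using T'_x[OF cy] T(1) cl nth(2) by (intro finsum_cong') auto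
    finally show "(\<Oplus>j\<in>{..<length (u # Us)}. T' j x \<otimes> (u # Us) ! j) = x"
      using T'_x[OF cy] T(4) cy by simp
  qed (use op in blast)
qed

text \<open>A basis over the centre spans the whole ring, so its coordinate operators take central
  values everywhere. By \<open>two_sided_op_representation\<close> the basis also supplies the left
  factors.\<close>

lemma exists_sandwich_basis:
  assumes "finite_dimension (ring_center R) (carrier R)"
  obtains k e \<beta> where "sandwich_basis R k e \<beta>"
proof -
  let ?K = "ring_center R"
  note K = subfield_ring_center
  from assms obtain n where n: "dimension n ?K (carrier R)" by (auto simp: finite_dimension_def)
  from exists_base[OF K n] obtain Us where Us: "set Us \<subseteq> carrier R" "independent ?K Us"
    "length Us = n" "Span ?K Us = carrier R" by blast
  from exists_coordinate_ops[OF Us(2)] obtain T where T: "\<And>j. j < n \<Longrightarrow> two_sided_op (T j)"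
    "\<And>j x. j < n \<Longrightarrow> x \<in> carrier R \<Longrightarrow> T j x \<in> ?K"
    "\<And>j i. j < n \<Longrightarrow> i < n \<Longrightarrow> T j (Us ! i) = (if i = j then \<one> else \<zero>)"
    "\<And>x. x \<in> carrier R \<Longrightarrow> (\<Oplus>j\<in>{..<n}. T j x \<otimes> Us ! j) = x"
    unfolding Us(3,4) by blast
  have e: "(!) Us \<in> {..<n} \<rightarrow> carrier R" using Us by auto
  have "\<exists>b. b \<in> {..<n} \<rightarrow> carrier R \<and> (\<forall>x \<in> carrier R. T j x = sandwich R n ((!) Us) b x)" if "j < n" for j
  proof -
    have "\<exists>c \<in> {..<n} \<rightarrow> ?K. x = (\<Oplus>s\<in>{..<n}. c s \<otimes> Us ! s)" if "x \<in> carrier R" for x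
      using T(2,4) that by (intro bexI[of _ "\<lambda>j. T j x"]) auto
    from two_sided_op_representation[OF T(1)[OF that] e this] show ?thesis by blast
  qed
  then obtain \<beta> where beta: "\<And>j. j < n \<Longrightarrow> \<beta> j \<in> {..<n} \<rightarrow> carrier R"
    "\<And>j x. j < n \<Longrightarrow> x \<in> carrier R \<Longrightarrow> sandwich R n ((!) Us) (\<beta> j) x = T j x" by metis
  have nth: "Us ! s \<in> carrier R" if "s < n" for s using e that by auto
  have "sandwich_basis R n ((!) Us) \<beta>"
  proof
    show "(\<Oplus>j\<in>{..<n}. sandwich R n ((!) Us) (\<beta> j) x \<otimes> Us ! j) = x" if "x \<in> carrier R" for x
    proof -
      have "(\<Oplus>j\<in>{..<n}. sandwich R n ((!) Us) (\<beta> j) x \<otimes> Us ! j) = (\<Oplus>j\<in>{..<n}. T j x \<otimes> Us ! j)"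
        using that beta(2) e T(1) by (intro finsum_cong') auto
      then show ?thesis using T(4) that by simp
    qed
  qed (use beta T nth in \<open>auto simp: Pi_iff\<close>)
  then show thesis by (rule that)
qed

end

section \<open>Scalar extension\<close>

context ring
begin

text \<open>Serves the induction over tensors, whose second case is a difference.\<close>

lemma additive_diff:
  assumes f: "\<And>x. x \<in> carrier R \<Longrightarrow> f x \<in> carrier R"
    "\<And>x y. x \<in> carrier R \<Longrightarrow> y \<in> carrier R \<Longrightarrow> f (x \<oplus> y) = f x \<oplus> f y"
    and xy: "x \<in> carrier R" "y \<in> carrier R"
  shows "f (x \<ominus> y) = f x \<ominus> f y"
proof -
  have "f x = f ((x \<ominus> y) \<oplus> y)" using xy by (simp add: minus_eq a_assoc l_neg)
  also have "\<dots> = f (x \<ominus> y) \<oplus> f y" using f(2)[of "x \<ominus> y" y] xy by simp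
  finally show ?thesis using f(1) xy by (simp add: minus_eq a_assoc r_neg)
qed

lemma sandwich_closed:
  "e \<in> {..<k} \<rightarrow> carrier R \<Longrightarrow> b \<in> {..<k} \<rightarrow> carrier R \<Longrightarrow> x \<in> carrier R \<Longrightarrow>
    sandwich R k e b x \<in> carrier R"
  by (auto simp: sandwich_def Pi_iff intro!: finsum_closed)

lemma sandwich_add:
  assumes "e \<in> {..<k} \<rightarrow> carrier R" "b \<in> {..<k} \<rightarrow> carrier R" "x \<in> carrier R" "y \<in> carrier R"
  shows "sandwich R k e b (x \<oplus> y) = sandwich R k e b x \<oplus> sandwich R k e b y"
proof -
  have "sandwich R k e b (x \<oplus> y) = (\<Oplus>s\<in>{..<k}. e s \<otimes> x \<otimes> b s \<oplus> e s \<otimes> y \<otimes> b s)"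
    unfolding sandwich_def using assms by (intro finsum_cong') (auto simp: Pi_iff l_distr r_distr)
  also have "\<dots> = sandwich R k e b x \<oplus> sandwich R k e b y"
    unfolding sandwich_def using assms by (intro finsum_addf) (auto simp: Pi_iff)
  finally show ?thesis .
qed

end

section \<open>Pure tensors and induction over the tensor product\<close>

definition pure_tensor ::
    "('f, 'c) ring_scheme \<Rightarrow> ('f, 'd, 'a) module_scheme \<Rightarrow> ('f, 'r, 'b) module_scheme \<Rightarrow>
      'd \<Rightarrow> 'r \<Rightarrow> ('d \<times> 'r \<Rightarrow>\<^sub>0 int) set" where
  "pure_tensor F D R d r = tensor_kernel F D R +>\<^bsub>free_pair_ring D R\<^esub> frag_of (d, r)"

locale algebra_tensor_product =
  D: assoc_algebra F D + R: algebra F R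
  for F :: "('f, 'c) ring_scheme" and D :: "('f, 'd, 'a) module_scheme"
    and R :: "('f, 'r, 'b) module_scheme"
begin

abbreviation T where "T \<equiv> tensor_algebra F D R"
abbreviation pure (infix "\<otimes>\<^sub>T" 75) where "d \<otimes>\<^sub>T r \<equiv> pure_tensor F D R d r"

sublocale K: ideal "tensor_kernel F D R" "free_pair_ring D R"
  by (rule ideal_tensor_kernel[OF D.assoc_algebra_axioms R.assoc_algebra])

sublocale T: ring T
  by (rule ring_tensor_algebra[OF D.assoc_algebra_axioms R.assoc_algebra])

lemma quotient_hom: "ring_hom_ring (free_pair_ring D R) T ((+>\<^bsub>free_pair_ring D R\<^esub>) (tensor_kernel F D R))"
  unfolding tensor_algebra_def by (rule K.rcos_ring_hom_ring)

sublocale h: ring_hom_ring "free_pair_ring D R" T "(+>\<^bsub>free_pair_ring D R\<^esub>) (tensor_kernel F D R)"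
  by (rule quotient_hom)

lemma frag_of_carrier [simp]:
  "d \<in> carrier D \<Longrightarrow> r \<in> carrier R \<Longrightarrow> frag_of (d, r) \<in> carrier (free_pair_ring D R)"
  by (simp add: free_pair_ring_def keys_frag_of)

lemma pure_closed [simp]:
  "d \<in> carrier D \<Longrightarrow> r \<in> carrier R \<Longrightarrow> d \<otimes>\<^sub>T r \<in> carrier T"
  using h.hom_closed[OF frag_of_carrier] by (simp add: pure_tensor_def)

lemma pure_mult:
  assumes "d \<in> carrier D" "r \<in> carrier R" "d' \<in> carrier D" "r' \<in> carrier R"
  shows "(d \<otimes>\<^sub>T r) \<otimes>\<^bsub>T\<^esub> (d' \<otimes>\<^sub>T r') = (d \<otimes>\<^bsub>D\<^esub> d') \<otimes>\<^sub>T (r \<otimes>\<^bsub>R\<^esub> r')"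
proof -
  have "frag_of (d \<otimes>\<^bsub>D\<^esub> d', r \<otimes>\<^bsub>R\<^esub> r') = frag_of (d, r) \<otimes>\<^bsub>free_pair_ring D R\<^esub> frag_of (d', r')"
    by (simp add: free_pair_ring_def)
  then show ?thesis using h.hom_mult[of "frag_of (d, r)" "frag_of (d', r')"] assms
    by (simp add: pure_tensor_def)
qed

lemma pure_one: "\<one>\<^bsub>D\<^esub> \<otimes>\<^sub>T \<one>\<^bsub>R\<^esub> = \<one>\<^bsub>T\<^esub>"
  using h.hom_one by (simp add: pure_tensor_def free_pair_ring_def)

text \<open>The two sides come from elements that differ by a defining relation, which the quotient
  map sends to zero.\<close>

lemma pure_add_left:
  assumes "d \<in> carrier D" "d' \<in> carrier D" "r \<in> carrier R"
  shows "(d \<oplus>\<^bsub>D\<^esub> d') \<otimes>\<^sub>T r = (d \<otimes>\<^sub>T r) \<oplus>\<^bsub>T\<^esub> (d' \<otimes>\<^sub>T r)"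
proof -
  let ?A = "free_pair_ring D R" and ?h = "(+>\<^bsub>free_pair_ring D R\<^esub>) (tensor_kernel F D R)"
  let ?x = "frag_of (d \<oplus>\<^bsub>D\<^esub> d', r) - frag_of (d, r) - frag_of (d', r)"
  have "?x \<in> tensor_relations F D R" using assms unfolding tensor_relations_def by blast
  then have x: "?x \<in> tensor_kernel F D R" unfolding tensor_kernel_def by (rule generate.incl)
  then have hx: "?h ?x = \<zero>\<^bsub>T\<^esub>"
    using K.a_rcos_const[OF x] by (simp only: tensor_algebra_def FactRing_def ring.simps)
  have xc: "?x \<in> carrier ?A" using x K.a_Hcarr by blast
  have "frag_of (d \<oplus>\<^bsub>D\<^esub> d', r) = ?x \<oplus>\<^bsub>?A\<^esub> (frag_of (d, r) \<oplus>\<^bsub>?A\<^esub> frag_of (d', r))"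
    by (simp add: free_pair_ring_def)
  moreover have "?h (x \<oplus>\<^bsub>?A\<^esub> (y \<oplus>\<^bsub>?A\<^esub> z)) = ?h x \<oplus>\<^bsub>T\<^esub> (?h y \<oplus>\<^bsub>T\<^esub> ?h z)"
    if "x \<in> carrier ?A" "y \<in> carrier ?A" "z \<in> carrier ?A" for x y z
    using that ring.ring_simprules(1)[OF ideal.axioms(2)[OF K.ideal_axioms]] by (simp add: h.hom_add)
  ultimately have "?h (frag_of (d \<oplus>\<^bsub>D\<^esub> d', r)) = ?h ?x \<oplus>\<^bsub>T\<^esub> (?h (frag_of (d, r)) \<oplus>\<^bsub>T\<^esub> ?h (frag_of (d', r)))"
    using xc assms by (metis frag_of_carrier)
  then show ?thesis using assms hx pure_closed[of d r] pure_closed[of d' r] by (simp add: pure_tensor_def)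
qed

lemma pure_zero_left:
  assumes "r \<in> carrier R"
  shows "\<zero>\<^bsub>D\<^esub> \<otimes>\<^sub>T r = \<zero>\<^bsub>T\<^esub>"
proof -
  have "(\<zero>\<^bsub>D\<^esub> \<otimes>\<^sub>T r) \<oplus>\<^bsub>T\<^esub> (\<zero>\<^bsub>D\<^esub> \<otimes>\<^sub>T r) = \<zero>\<^bsub>D\<^esub> \<otimes>\<^sub>T r"
    using pure_add_left[of "\<zero>\<^bsub>D\<^esub>" "\<zero>\<^bsub>D\<^esub>" r] assms by simp
  then show ?thesis using assms by (simp add: T.add.r_cancel_one)
qed

lemma pure_finsum_left:
  assumes "finite I" "f \<in> I \<rightarrow> carrier D" "r \<in> carrier R"
  shows "(\<Oplus>\<^bsub>D\<^esub>i\<in>I. f i) \<otimes>\<^sub>T r = (\<Oplus>\<^bsub>T\<^esub>i\<in>I. f i \<otimes>\<^sub>T r)"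
  using assms(1,2)
proof (induction I rule: finite_induct)
  case empty
  then show ?case using pure_zero_left assms(3) by simp
next
  case (insert i I)
  then show ?case using assms(3)
    by (simp add: Pi_iff D.M.finsum_insert T.finsum_insert pure_add_left D.M.finsum_closed)
qed

text \<open>Every element of the free abelian group arises from the generators by iterated
  differences, and passing to cosets turns generators into pure tensors.\<close>

lemma tensor_induct [consumes 1, case_names pure diff]:
  assumes "x \<in> carrier T"
    and pure: "\<And>d r. d \<in> carrier D \<Longrightarrow> r \<in> carrier R \<Longrightarrow> Q (d \<otimes>\<^sub>T r)"
    and diff: "\<And>x y. x \<in> carrier T \<Longrightarrow> y \<in> carrier T \<Longrightarrow> Q x \<Longrightarrow> Q y \<Longrightarrow> Q (x \<ominus>\<^bsub>T\<^esub> y)"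
  shows "Q x"
proof -
  let ?A = "free_pair_ring D R" and ?h = "(+>\<^bsub>free_pair_ring D R\<^esub>) (tensor_kernel F D R)"
  let ?S = "carrier D \<times> carrier R"
  have carr: "y \<in> carrier ?A \<longleftrightarrow> Poly_Mapping.keys y \<subseteq> ?S" for y
    by (simp add: free_pair_ring_def)
  obtain y where y: "y \<in> carrier ?A" "x = ?h y"
    using assms(1) unfolding tensor_algebra_def FactRing_def partial_object.simps A_RCOSETS_def'
    by blast
  \<comment> \<open>Induction on the free abelian group also asks for zero, which is a pure tensor
    minus itself.\<close>
  have zero: "Q (?h 0)"
  proof -
    have "0 = \<zero>\<^bsub>?A\<^esub>" by (simp add: free_pair_ring_def)
    then have "?h 0 = \<zero>\<^bsub>T\<^esub>" using h.hom_zero by simp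
    also have "\<dots> = (\<one>\<^bsub>D\<^esub> \<otimes>\<^sub>T \<one>\<^bsub>R\<^esub>) \<ominus>\<^bsub>T\<^esub> (\<one>\<^bsub>D\<^esub> \<otimes>\<^sub>T \<one>\<^bsub>R\<^esub>)"
      by (simp add: T.minus_eq T.r_neg)
    also have "Q \<dots>" by (intro diff pure) auto
    finally show ?thesis .
  qed
  \<comment> \<open>The support condition is part of the induction claim because the difference step
    says nothing else about the supports of \<open>a\<close> and \<open>b\<close>.\<close>
  have "Poly_Mapping.keys y \<subseteq> ?S \<and> Q (?h y)"
    using y(1)[unfolded carr]
  proof (induction y rule: frag_induction)
    case zero
    then show ?case using \<open>Q (?h 0)\<close> by simp
  next
    case (one p)
    then show ?case using pure[of "fst p" "snd p"] by (auto simp: pure_tensor_def keys_frag_of)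
  next
    case (diff a b)
    then have ab: "a \<in> carrier ?A" "b \<in> carrier ?A" and d: "a - b \<in> carrier ?A"
      using keys_diff[of a b] by (auto simp: carr)
    have "a = (a - b) \<oplus>\<^bsub>?A\<^esub> b" by (simp add: free_pair_ring_def)
    then have "?h a = ?h (a - b) \<oplus>\<^bsub>T\<^esub> ?h b" using d ab h.hom_add[of "a - b" b] by simp
    then have "?h (a - b) = ?h a \<ominus>\<^bsub>T\<^esub> ?h b"
      using h.hom_closed[OF d] h.hom_closed[OF ab(2)] by (simp add: T.minus_eq T.a_assoc T.r_neg)
    then show ?case
      using assms(3)[of "?h a" "?h b"] h.hom_closed[OF ab(1)] h.hom_closed[OF ab(2)] diff d carr by simp
  qed
  then show ?thesis using y by blast
qed

text \<open>Against a pure tensor both components commute, the second because \<open>R\<close> is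
  commutative; differences follow by distributivity.\<close>

lemma pure_central:
  assumes z: "z \<in> ring_center D" and r: "r \<in> carrier R"
  shows "z \<otimes>\<^sub>T r \<in> ring_center T"
proof -
  note zD = ring_centerD(1)[OF z]
  have "(z \<otimes>\<^sub>T r) \<otimes>\<^bsub>T\<^esub> x = x \<otimes>\<^bsub>T\<^esub> (z \<otimes>\<^sub>T r)" if "x \<in> carrier T" for x
    using that
  proof (induction x rule: tensor_induct)
    case (pure d s)
    then show ?case using zD r ring_centerD(2)[OF z pure(1)] comm_monoid.m_comm[OF cring.axioms(2)[OF R.M_cring] r pure(2)] by (simp add: pure_mult)
  next
    case (diff x y)
    then show ?case using zD r by (simp add: T.minus_eq T.l_distr T.r_distr T.l_minus T.r_minus)
  qed
  then show ?thesis using zD r by (simp add: ring_center_def)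
qed

text \<open>The extended factors act only on the \<open>D\<close> component of a pure tensor. So
  each condition holds on pure tensors by the one for \<open>D\<close>, and the general case follows
  by additivity.\<close>

lemma sandwich_basis_tensor:
  assumes "sandwich_basis D k e \<beta>"
  shows "sandwich_basis T k (\<lambda>s. e s \<otimes>\<^sub>T \<one>\<^bsub>R\<^esub>) (\<lambda>j s. \<beta> j s \<otimes>\<^sub>T \<one>\<^bsub>R\<^esub>)"
proof -
  interpret B: sandwich_basis D k e \<beta> by fact
  interpret Z: subcring "ring_center T" T by (rule T.subcring_ring_center)
  let ?e = "\<lambda>s. e s \<otimes>\<^sub>T \<one>\<^bsub>R\<^esub>" and ?b = "\<lambda>j s. \<beta> j s \<otimes>\<^sub>T \<one>\<^bsub>R\<^esub>"
  have e: "?e \<in> {..<k} \<rightarrow> carrier T" by auto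
  have b: "?b j \<in> {..<k} \<rightarrow> carrier T" if "j < k" for j using that by auto
  note closed = T.sandwich_closed[OF e b] and add = T.sandwich_add[OF e b]
  have diff': "sandwich T k ?e (?b j) (x \<ominus>\<^bsub>T\<^esub> y) =
      sandwich T k ?e (?b j) x \<ominus>\<^bsub>T\<^esub> sandwich T k ?e (?b j) y"
    if "j < k" "x \<in> carrier T" "y \<in> carrier T" for j x y
    using that closed add by (intro T.additive_diff) auto
  have pure': "sandwich T k ?e (?b j) (d \<otimes>\<^sub>T r) = sandwich D k e (\<beta> j) d \<otimes>\<^sub>T r"
    if j: "j < k" and d: "d \<in> carrier D" and r: "r \<in> carrier R" for j d r
  proof -
    have "sandwich T k ?e (?b j) (d \<otimes>\<^sub>T r) =
      (\<Oplus>\<^bsub>T\<^esub>s\<in>{..<k}. (e s \<otimes>\<^bsub>D\<^esub> d \<otimes>\<^bsub>D\<^esub> \<beta> j s) \<otimes>\<^sub>T r)"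
      unfolding sandwich_def using j d r by (intro T.finsum_cong') (auto simp: pure_mult)
    also have "\<dots> = sandwich D k e (\<beta> j) d \<otimes>\<^sub>T r"
      unfolding sandwich_def using j d r by (subst pure_finsum_left) auto
    finally show ?thesis .
  qed
  have center: "sandwich T k ?e (?b j) x \<in> ring_center T" if j: "j < k" and x: "x \<in> carrier T" for j x
    using x
  proof (induction x rule: tensor_induct)
    case (pure d r)
    then show ?case using pure'[OF j] pure_central B.coord_central[OF j] by simp
  next
    case (diff x y)
    then show ?case
      using diff'[OF j] subringE(5,7)[OF Z.subring_axioms] by (simp add: T.minus_eq)
  qed
  have expand: "(\<Oplus>\<^bsub>T\<^esub>j\<in>{..<k}. sandwich T k ?e (?b j) x \<otimes>\<^bsub>T\<^esub> ?e j) = x" (is "?E x = x")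
    if x: "x \<in> carrier T" for x
    using x
  proof (induction x rule: tensor_induct)
    case (pure d r)
    have "?E (d \<otimes>\<^sub>T r) = (\<Oplus>\<^bsub>T\<^esub>j\<in>{..<k}. (sandwich D k e (\<beta> j) d \<otimes>\<^bsub>D\<^esub> e j) \<otimes>\<^sub>T r)"
      using pure ring_centerD(1)[OF B.coord_central]
      by (intro T.finsum_cong') (auto simp: pure' pure_mult)
    also have "\<dots> = d \<otimes>\<^sub>T r"
      using pure ring_centerD(1)[OF B.coord_central] B.expansion by (subst pure_finsum_left[symmetric]) auto
    finally show ?case .
  next
    case (diff x y)
    have "?E (x \<ominus>\<^bsub>T\<^esub> y) = ?E x \<ominus>\<^bsub>T\<^esub> ?E y"
    proof (rule T.additive_diff[OF _ _ diff(1,2)])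
      show "?E x \<in> carrier T" if "x \<in> carrier T" for x
        using that closed by (intro T.finsum_closed) auto
      show "?E (x \<oplus>\<^bsub>T\<^esub> y) = ?E x \<oplus>\<^bsub>T\<^esub> ?E y" if "x \<in> carrier T" "y \<in> carrier T" for x y
      proof -
        have "?E (x \<oplus>\<^bsub>T\<^esub> y) = (\<Oplus>\<^bsub>T\<^esub>j\<in>{..<k}. sandwich T k ?e (?b j) x \<otimes>\<^bsub>T\<^esub> ?e j
            \<oplus>\<^bsub>T\<^esub> sandwich T k ?e (?b j) y \<otimes>\<^bsub>T\<^esub> ?e j)"
          using that closed by (intro T.finsum_cong') (auto simp: add T.l_distr)
        also have "\<dots> = ?E x \<oplus>\<^bsub>T\<^esub> ?E y"
          using that closed by (intro T.finsum_addf) auto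
        finally show ?thesis .
      qed
    qed
    then show ?case using diff by simp
  qed
  show ?thesis
  proof
    show "sandwich T k ?e (?b j) (?e s) = (if s = j then \<one>\<^bsub>T\<^esub> else \<zero>\<^bsub>T\<^esub>)" if "j < k" "s < k" for j s
      using that pure'[of j "e s" "\<one>\<^bsub>R\<^esub>"] B.coord_e[of j s] pure_zero_left pure_one by simp
  qed (use center expand in auto)
qed

end

section \<open>Prime submodules of free modules\<close>

context ring
begin

lemma finsum_Times:
  assumes "finite I" "finite J" "f \<in> I \<times> J \<rightarrow> carrier R"
  shows "(\<Oplus>x\<in>I \<times> J. f x) = (\<Oplus>i\<in>I. \<Oplus>j\<in>J. f (i, j))"
  using assms(1,3)
proof (induction I rule: finite_induct)
  case (insert i I)
  have "(\<Oplus>x\<in>insert i I \<times> J. f x) = (\<Oplus>x\<in>Pair i ` J \<union> I \<times> J. f x)"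
    by (rule arg_cong[where f = "finsum R f"]) auto
  also have "\<dots> = (\<Oplus>x\<in>Pair i ` J. f x) \<oplus> (\<Oplus>x\<in>I \<times> J. f x)"
    using insert assms(2) by (intro finsum_Un_disjoint) auto
  also have "(\<Oplus>x\<in>Pair i ` J. f x) = (\<Oplus>j\<in>J. f (i, j))"
    using insert.prems by (intro finsum_reindex) (auto simp: inj_on_def)
  also have "(\<Oplus>x\<in>I \<times> J. f x) = (\<Oplus>i\<in>I. \<Oplus>j\<in>J. f (i, j))" using insert by auto
  also have "(\<Oplus>j\<in>J. f (i, j)) \<oplus> \<dots> = (\<Oplus>i\<in>insert i I. \<Oplus>j\<in>J. f (i, j))"
    using insert by (subst finsum_insert) (auto intro!: finsum_closed)
  finally show ?case .
qed simp

lemma finsum_swap: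
  assumes "finite I" "finite J" "\<And>i j. i \<in> I \<Longrightarrow> j \<in> J \<Longrightarrow> f i j \<in> carrier R"
  shows "(\<Oplus>i\<in>I. \<Oplus>j\<in>J. f i j) = (\<Oplus>j\<in>J. \<Oplus>i\<in>I. f i j)"
  using assms(1,3)
proof (induction I rule: finite_induct)
  case (insert i I)
  have "(\<Oplus>i\<in>insert i I. \<Oplus>j\<in>J. f i j) = (\<Oplus>j\<in>J. f i j) \<oplus> (\<Oplus>j\<in>J. \<Oplus>i\<in>I. f i j)"
    using insert by (subst finsum_insert) (auto intro!: finsum_closed)
  also have "\<dots> = (\<Oplus>j\<in>J. f i j \<oplus> (\<Oplus>i\<in>I. f i j))"
    using insert.prems by (subst finsum_addf) (auto intro!: finsum_closed)
  also have "\<dots> = (\<Oplus>j\<in>J. \<Oplus>i\<in>insert i I. f i j)"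
    using insert by (intro finsum_cong' refl finsum_insert[symmetric]) (auto intro!: finsum_closed)
  finally show ?case .
qed simp

lemma finsum_carrier_restrict:
  assumes "subring S R" "finite I" "f \<in> I \<rightarrow> S"
  shows "finsum (R\<lparr>carrier := S\<rparr>) f I = finsum R f I"
proof -
  interpret S: ring "R\<lparr>carrier := S\<rparr>" by (rule subring_is_ring[OF assms(1)])
  show ?thesis
    using assms(2,3)
  proof (induction I rule: finite_induct)
    case empty
    then show ?case using S.finsum_empty[of f] by simp
  next
    case (insert i I)
    have "finsum (R\<lparr>carrier := S\<rparr>) f (insert i I) = f i \<oplus> finsum (R\<lparr>carrier := S\<rparr>) f I"
      using insert by (subst S.finsum_insert) auto
    then show ?case
      using insert subringE(1)[OF assms(1)] by (subst finsum_insert) auto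
  qed
qed

lemma finsum_mem_ideal:
  assumes "ideal I R" "finite J" "\<And>j. j \<in> J \<Longrightarrow> f j \<in> I"
  shows "finsum R f J \<in> I"
  using assms(2,3)
proof (induction J rule: finite_induct)
  interpret I: ideal I R by fact
  case empty
  then show ?case by simp
next
  interpret I: ideal I R by fact
  case (insert j J)
  then show ?case by (subst finsum_insert) (auto intro: I.a_closed)
qed

section \<open>The free module over a ring and over its centre\<close>

abbreviation center_ring where "center_ring \<equiv> R\<lparr>carrier := ring_center R\<rparr>"

lemma cring_center_ring: "cring center_ring"
  using subcring_ring_center subcring_iff[of "ring_center R"] by (auto simp: ring_center_def)

lemma power_module_carrier: "carrier (power_module R n) = {..<n} \<rightarrow>\<^sub>E carrier R"
  by (simp add: power_module_def)

lemma power_module_nth [simp]: "m \<in> carrier (power_module R n) \<Longrightarrow> i < n \<Longrightarrow> m i \<in> carrier R"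
  by (auto simp: power_module_def)

lemma power_module_eqI:
  "x \<in> carrier (power_module R n) \<Longrightarrow> y \<in> carrier (power_module R n) \<Longrightarrow>
    (\<And>i. i < n \<Longrightarrow> x i = y i) \<Longrightarrow> x = y"
  by (rule PiE_ext[of _ "{..<n}" "\<lambda>_. carrier R"]) (auto simp: power_module_carrier)

lemma power_module_apply [simp]:
  "i < n \<Longrightarrow> (x \<oplus>\<^bsub>power_module R n\<^esub> y) i = x i \<oplus> y i"
  "i < n \<Longrightarrow> (a \<odot>\<^bsub>power_module R n\<^esub> x) i = a \<otimes> x i"
  "i < n \<Longrightarrow> \<zero>\<^bsub>power_module R n\<^esub> i = \<zero>"
  by (simp_all add: power_module_def)

lemma power_module_closed [simp]:
  "x \<in> carrier (power_module R n) \<Longrightarrow> y \<in> carrier (power_module R n) \<Longrightarrow>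
    x \<oplus>\<^bsub>power_module R n\<^esub> y \<in> carrier (power_module R n)"
  "a \<in> carrier R \<Longrightarrow> x \<in> carrier (power_module R n) \<Longrightarrow>
    a \<odot>\<^bsub>power_module R n\<^esub> x \<in> carrier (power_module R n)"
  "\<zero>\<^bsub>power_module R n\<^esub> \<in> carrier (power_module R n)"
  by (auto simp: power_module_def)

lemma power_module_smult_assoc:
  assumes "a \<in> carrier R" "b \<in> carrier R" "x \<in> carrier (power_module R n)"
  shows "(a \<otimes> b) \<odot>\<^bsub>power_module R n\<^esub> x = a \<odot>\<^bsub>power_module R n\<^esub> (b \<odot>\<^bsub>power_module R n\<^esub> x)"
  using assms by (intro power_module_eqI[of _ n]) (auto simp: m_assoc)

lemma abelian_group_power_module: "abelian_group (power_module R n)"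
proof (rule abelian_groupI)
  fix x assume x: "x \<in> carrier (power_module R n)"
  have "\<ominus> \<one> \<odot>\<^bsub>power_module R n\<^esub> x \<oplus>\<^bsub>power_module R n\<^esub> x = \<zero>\<^bsub>power_module R n\<^esub>"
    using x by (intro power_module_eqI[of _ n]) (auto simp: l_minus l_neg)
  then show "\<exists>y\<in>carrier (power_module R n). y \<oplus>\<^bsub>power_module R n\<^esub> x = \<zero>\<^bsub>power_module R n\<^esub>"
    using x by (intro bexI[of _ "\<ominus> \<one> \<odot>\<^bsub>power_module R n\<^esub> x"]) auto
next
  fix x y z
  assume x: "x \<in> carrier (power_module R n)" "y \<in> carrier (power_module R n)" "z \<in> carrier (power_module R n)"
  show "x \<oplus>\<^bsub>power_module R n\<^esub> y \<oplus>\<^bsub>power_module R n\<^esub> z =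
      x \<oplus>\<^bsub>power_module R n\<^esub> (y \<oplus>\<^bsub>power_module R n\<^esub> z)"
    using x by (intro power_module_eqI[of _ n]) (auto simp: a_assoc)
next
  fix x y
  assume x: "x \<in> carrier (power_module R n)" "y \<in> carrier (power_module R n)"
  show "x \<oplus>\<^bsub>power_module R n\<^esub> y = y \<oplus>\<^bsub>power_module R n\<^esub> x"
    using x by (intro power_module_eqI[of _ n]) (auto simp: a_comm)
next
  fix x assume x: "x \<in> carrier (power_module R n)"
  show "\<zero>\<^bsub>power_module R n\<^esub> \<oplus>\<^bsub>power_module R n\<^esub> x = x"
    using x by (intro power_module_eqI[of _ n]) auto
qed auto

text \<open>Restriction of scalars: the ring itself may be noncommutative, while the separation
  result concerns modules over commutative rings.\<close>

lemma module_power_module_center: "module center_ring (power_module R n)"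
proof (rule moduleI[OF cring_center_ring abelian_group_power_module])
  fix a b x y
  assume h: "a \<in> carrier center_ring" "b \<in> carrier center_ring"
    "x \<in> carrier (power_module R n)" "y \<in> carrier (power_module R n)"
  then have ab: "a \<in> carrier R" "b \<in> carrier R" by (auto dest: ring_centerD(1))
  show "(a \<oplus>\<^bsub>center_ring\<^esub> b) \<odot>\<^bsub>power_module R n\<^esub> x =
      a \<odot>\<^bsub>power_module R n\<^esub> x \<oplus>\<^bsub>power_module R n\<^esub> b \<odot>\<^bsub>power_module R n\<^esub> x"
    using ab h by (intro power_module_eqI[of _ n]) (auto simp: l_distr)
  show "a \<odot>\<^bsub>power_module R n\<^esub> (x \<oplus>\<^bsub>power_module R n\<^esub> y) =
      a \<odot>\<^bsub>power_module R n\<^esub> x \<oplus>\<^bsub>power_module R n\<^esub> a \<odot>\<^bsub>power_module R n\<^esub> y"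
    using ab h by (intro power_module_eqI[of _ n]) (auto simp: r_distr)
  show "(a \<otimes>\<^bsub>center_ring\<^esub> b) \<odot>\<^bsub>power_module R n\<^esub> x =
      a \<odot>\<^bsub>power_module R n\<^esub> (b \<odot>\<^bsub>power_module R n\<^esub> x)"
    using ab h by (simp add: power_module_smult_assoc)
next
  fix x assume x: "x \<in> carrier (power_module R n)"
  show "\<one>\<^bsub>center_ring\<^esub> \<odot>\<^bsub>power_module R n\<^esub> x = x"
    using x by (intro power_module_eqI[of _ n]) auto
qed (auto dest: ring_centerD(1))

lemma finsum_power_module_apply:
  assumes "finite J" "f \<in> J \<rightarrow> carrier (power_module R n)" "i < n"
  shows "finsum (power_module R n) f J i = (\<Oplus>j\<in>J. f j i)"
proof -
  interpret M: abelian_group "power_module R n" by (rule abelian_group_power_module)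
  show ?thesis
    using assms(1,2)
  proof (induction J rule: finite_induct)
    case empty
    then show ?case using assms(3) by simp
  next
    case (insert j J)
    then have "f x i \<in> carrier R" if "x \<in> insert j J" for x
      using that assms(3) by (intro power_module_nth[of _ n]) auto
    then show ?case using insert assms(3) by (simp add: Pi_iff)
  qed
qed

section \<open>The pairing and the prime submodules that it defines\<close>

lemma pairing_closed [simp]:
  "m \<in> carrier (power_module R n) \<Longrightarrow> u \<in> carrier (power_module R n) \<Longrightarrow> pairing R n m u \<in> carrier R"
  unfolding pairing_def by (intro finsum_closed) auto

lemma pairing_add_left:
  assumes "m \<in> carrier (power_module R n)" "m' \<in> carrier (power_module R n)" "u \<in> carrier (power_module R n)"
  shows "pairing R n (m \<oplus>\<^bsub>power_module R n\<^esub> m') u = pairing R n m u \<oplus> pairing R n m' u"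
proof -
  have "pairing R n (m \<oplus>\<^bsub>power_module R n\<^esub> m') u = (\<Oplus>i\<in>{..<n}. m i \<otimes> u i \<oplus> m' i \<otimes> u i)"
    unfolding pairing_def using assms by (intro finsum_cong') (auto simp: l_distr)
  also have "\<dots> = pairing R n m u \<oplus> pairing R n m' u"
    unfolding pairing_def using assms by (intro finsum_addf) auto
  finally show ?thesis .
qed

lemma pairing_smult_left:
  assumes "a \<in> carrier R" "m \<in> carrier (power_module R n)" "u \<in> carrier (power_module R n)"
  shows "pairing R n (a \<odot>\<^bsub>power_module R n\<^esub> m) u = a \<otimes> pairing R n m u"
proof -
  have "pairing R n (a \<odot>\<^bsub>power_module R n\<^esub> m) u = (\<Oplus>i\<in>{..<n}. a \<otimes> (m i \<otimes> u i))"
    unfolding pairing_def using assms by (intro finsum_cong') (auto simp: m_assoc)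
  also have "\<dots> = a \<otimes> pairing R n m u"
    unfolding pairing_def using assms by (intro finsum_rdistr[symmetric]) auto
  finally show ?thesis .
qed

definition unit_vector :: "nat \<Rightarrow> nat \<Rightarrow> 'a \<Rightarrow> nat \<Rightarrow> 'a" where
  "unit_vector n i a = (\<lambda>l\<in>{..<n}. if l = i then a else \<zero>)"

lemma unit_vector_closed [simp]:
  "a \<in> carrier R \<Longrightarrow> unit_vector n i a \<in> carrier (power_module R n)"
  by (auto simp: unit_vector_def power_module_carrier)

lemma unit_vector_nth [simp]: "l < n \<Longrightarrow> a \<in> carrier R \<Longrightarrow> unit_vector n i a l \<in> carrier R"
  by (simp add: unit_vector_def)

lemma pairing_unit_vector:
  assumes "i < n" "a \<in> carrier R" "u \<in> carrier (power_module R n)"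
  shows "pairing R n (unit_vector n i a) u = a \<otimes> u i"
proof -
  have "pairing R n (unit_vector n i a) u = (\<Oplus>l\<in>{..<n}. if i = l then a \<otimes> u l else \<zero>)"
    unfolding pairing_def using assms by (intro finsum_cong') (auto simp: unit_vector_def)
  also have "\<dots> = a \<otimes> u i" using assms by (intro finsum_singleton) auto
  finally show ?thesis .
qed

text \<open>Negatives are multiples by \<open>\<ominus> \<one>\<close>. The additive structure is
  checked over the centre, and closure under all scalars is then put back.\<close>

lemma submodule_power_moduleI:
  assumes "H \<subseteq> carrier (power_module R n)" "\<zero>\<^bsub>power_module R n\<^esub> \<in> H"
    and "\<And>x y. x \<in> H \<Longrightarrow> y \<in> H \<Longrightarrow> x \<oplus>\<^bsub>power_module R n\<^esub> y \<in> H"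
    and "\<And>a x. a \<in> carrier R \<Longrightarrow> x \<in> H \<Longrightarrow> a \<odot>\<^bsub>power_module R n\<^esub> x \<in> H"
  shows "submodule H R (power_module R n)"
proof -
  interpret M: module center_ring "power_module R n" by (rule module_power_module_center)
  have "\<ominus>\<^bsub>power_module R n\<^esub> x \<in> H" if x: "x \<in> H" for x
  proof -
    have xM: "x \<in> carrier (power_module R n)" using assms(1) x by blast
    have "\<ominus> \<one> \<odot>\<^bsub>power_module R n\<^esub> x \<oplus>\<^bsub>power_module R n\<^esub> x = \<zero>\<^bsub>power_module R n\<^esub>"
      using xM by (intro power_module_eqI[of _ n]) (auto simp: l_minus l_neg)
    then have "\<ominus>\<^bsub>power_module R n\<^esub> x = \<ominus> \<one> \<odot>\<^bsub>power_module R n\<^esub> x"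
      using xM by (intro M.M.minus_equality) auto
    then show ?thesis using assms(4)[of "\<ominus> \<one>" x] x by simp
  qed
  then have "submodule H center_ring (power_module R n)"
    using assms ring_centerD(1)[of _ R] by (intro M.submoduleI) auto
  then show ?thesis
    by (rule submodule.intro[OF submodule.axioms(1) submodule_axioms.intro[OF assms(4)]])
qed

lemma submodule_center:
  assumes "submodule H R (power_module R n)"
  shows "submodule H center_ring (power_module R n)"
proof (rule submodule.intro[OF submodule.axioms(1)[OF assms] submodule_axioms.intro])
  show "a \<odot>\<^bsub>power_module R n\<^esub> x \<in> H" if "a \<in> carrier center_ring" "x \<in> H" for a x
    using submodule.smult_closed[OF assms] ring_centerD(1)[of a R] that by simp
qed

lemma power_submodule_props:
  assumes "submodule H R (power_module R n)"
  shows "H \<subseteq> carrier (power_module R n)" "\<zero>\<^bsub>power_module R n\<^esub> \<in> H"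
    and "\<And>x y. x \<in> H \<Longrightarrow> y \<in> H \<Longrightarrow> x \<oplus>\<^bsub>power_module R n\<^esub> y \<in> H"
    and "\<And>a x. a \<in> carrier R \<Longrightarrow> x \<in> H \<Longrightarrow> a \<odot>\<^bsub>power_module R n\<^esub> x \<in> H"
  using subgroup.subset[OF submodule.axioms(1)[OF assms]] subgroup.one_closed[OF submodule.axioms(1)[OF assms]]
    subgroup.m_closed[OF submodule.axioms(1)[OF assms]] submodule.smult_closed[OF assms] by auto

text \<open>Both conditions reduce to primeness of \<open>P\<close>. If \<open>a\<close> maps the
  whole module into the submodule, unit vectors give
  \<open>a \<otimes> b \<otimes> u i \<in> P\<close> for all \<open>b\<close>, and some
  \<open>u i\<close> is outside \<open>P\<close>. For the prime condition, the value of the pairing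
  at \<open>m\<close> takes the place of \<open>u i\<close>.\<close>

lemma P_prime_submodule_C_submodule:
  assumes P: "two_sided_prime_ideal R P"
    and u: "u \<in> carrier (power_module R n)" "u \<notin> {..<n} \<rightarrow>\<^sub>E P"
  shows "P_prime_submodule R (power_module R n) P (C_submodule R n P u)"
proof -
  let ?M = "power_module R n" and ?C = "C_submodule R n P u"
  have I: "ideal P R" using P by (simp add: two_sided_prime_ideal_def)
  interpret P: ideal P R by fact
  have prime: "x \<in> P \<or> y \<in> P"
    if "x \<in> carrier R" "y \<in> carrier R" "\<And>a. a \<in> carrier R \<Longrightarrow> x \<otimes> a \<otimes> y \<in> P" for x y
    using P that unfolding two_sided_prime_ideal_def by blast
  have zero: "pairing R n \<zero>\<^bsub>?M\<^esub> u = \<zero>"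
  proof -
    have "pairing R n \<zero>\<^bsub>?M\<^esub> u = (\<Oplus>i\<in>{..<n}. \<zero>)"
      unfolding pairing_def using u(1) by (intro finsum_cong') auto
    then show ?thesis by simp
  qed
  have sub: "submodule ?C R ?M"
  proof (rule submodule_power_moduleI)
    show "\<zero>\<^bsub>?M\<^esub> \<in> ?C" using zero by (simp add: C_submodule_def)
    show "x \<oplus>\<^bsub>?M\<^esub> y \<in> ?C" if "x \<in> ?C" "y \<in> ?C" for x y
      using that u by (simp add: C_submodule_def pairing_add_left P.a_closed)
    show "a \<odot>\<^bsub>?M\<^esub> x \<in> ?C" if "a \<in> carrier R" "x \<in> ?C" for a x
      using that u by (simp add: C_submodule_def pairing_smult_left P.I_l_closed)
  qed (auto simp: C_submodule_def)
  obtain i where i: "i < n" "u i \<notin> P" using u by (auto simp: power_module_carrier PiE_iff)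
  have "a \<in> P" if a: "a \<in> carrier R" and aM: "\<And>m. m \<in> carrier ?M \<Longrightarrow> a \<odot>\<^bsub>?M\<^esub> m \<in> ?C" for a
  proof -
    have "a \<otimes> b \<otimes> u i \<in> P" if b: "b \<in> carrier R" for b
      using aM[of "unit_vector n i b"] a b i u
      by (simp add: C_submodule_def pairing_smult_left pairing_unit_vector m_assoc)
    then show ?thesis using prime[of a "u i"] a i u by auto
  qed
  moreover have "a \<in> carrier R \<and> a \<odot>\<^bsub>?M\<^esub> m \<in> ?C" if a: "a \<in> P" and m: "m \<in> carrier ?M" for a m
  proof -
    have "a \<otimes> pairing R n m u \<in> P" using m u(1) by (intro P.I_r_closed[OF a]) simp
    then show ?thesis using P.a_Hcarr[OF a] m u(1) by (simp add: C_submodule_def pairing_smult_left)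
  qed
  ultimately have colon: "module_colon R ?M ?C = P"
    using P.a_Hcarr unfolding module_colon_def by blast
  have "a \<in> P \<or> m \<in> ?C" if a: "a \<in> carrier R" and m: "m \<in> carrier ?M"
    and h: "\<And>b. b \<in> carrier R \<Longrightarrow> (a \<otimes> b) \<odot>\<^bsub>?M\<^esub> m \<in> ?C" for a m
  proof -
    have "a \<otimes> b \<otimes> pairing R n m u \<in> P" if b: "b \<in> carrier R" for b
      using h[OF b] a b m u(1) by (simp add: C_submodule_def pairing_smult_left)
    then show ?thesis using prime[of a "pairing R n m u"] a m u(1) by (auto simp: C_submodule_def)
  qed
  then show ?thesis using sub colon by (simp add: P_prime_submodule_def prime_submodule_def)
qed

text \<open>The colon of an intersection is the intersection of the colons. For \<open>a\<close>
  outside \<open>P\<close>, primeness of each member puts \<open>m\<close> into all of them.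
  Nonemptiness keeps the intersection inside the module, since \<open>\<Inter> {}\<close> is
  \<open>UNIV\<close>.\<close>

lemma P_prime_submodule_Inter:
  assumes ne: "\<C> \<noteq> {}" and prime: "\<And>L. L \<in> \<C> \<Longrightarrow> P_prime_submodule R (power_module R n) P L"
  shows "P_prime_submodule R (power_module R n) P (\<Inter>\<C>)"
proof -
  let ?M = "power_module R n"
  have sub: "submodule L R ?M" and colon: "module_colon R ?M L = P"
    and pr: "\<And>a m. a \<in> carrier R \<Longrightarrow> m \<in> carrier ?M \<Longrightarrow>
      (\<And>b. b \<in> carrier R \<Longrightarrow> (a \<otimes> b) \<odot>\<^bsub>?M\<^esub> m \<in> L) \<Longrightarrow> a \<in> P \<or> m \<in> L" if "L \<in> \<C>" for L
    using prime[OF that] unfolding P_prime_submodule_def prime_submodule_def by auto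
  note props = power_submodule_props[OF sub]
  have "submodule (\<Inter>\<C>) R ?M"
  proof (rule submodule_power_moduleI)
    show "\<Inter>\<C> \<subseteq> carrier ?M" using ne props(1) by blast
  qed (use props(2-4) in auto)
  moreover have "module_colon R ?M (\<Inter>\<C>) = P"
  proof -
    have "module_colon R ?M (\<Inter>\<C>) = (\<Inter>L\<in>\<C>. module_colon R ?M L)"
      using ne by (auto simp: module_colon_def)
    then show ?thesis using ne colon by auto
  qed
  ultimately show ?thesis using pr unfolding P_prime_submodule_def prime_submodule_def by blast
qed

end

section \<open>Separating a vector from a prime submodule by a pairing\<close>

context sandwich_basis
begin

abbreviation coord where "coord j x \<equiv> sandwich A k e (\<beta> j) x"

lemma coord_closed [simp]: "j < k \<Longrightarrow> x \<in> carrier A \<Longrightarrow> coord j x \<in> carrier A"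
  using ring_centerD(1)[OF coord_central] .

text \<open>Entry by entry this is \<open>expansion\<close>: at position \<open>l\<close> only the
  terms with first index \<open>l\<close> survive. So the vectors with a single nonzero entry
  \<open>e j\<close> span over the centre.\<close>

lemma power_module_expansion:
  assumes m: "m \<in> carrier (power_module A n)"
  shows "(\<Oplus>\<^bsub>power_module A n\<^esub>x\<in>{..<n} \<times> {..<k}.
      coord (snd x) (m (fst x)) \<odot>\<^bsub>power_module A n\<^esub> unit_vector n (fst x) (e (snd x))) = m"
    (is "finsum ?M ?f ?J = m")
proof (rule power_module_eqI[of _ n])
  interpret M: abelian_group ?M by (rule abelian_group_power_module)
  have f: "?f \<in> ?J \<rightarrow> carrier ?M" using m by auto
  show "finsum ?M ?f ?J \<in> carrier ?M" using f by (rule M.finsum_closed)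
  fix l assume l: "l < n"
  have "finsum ?M ?f ?J l = (\<Oplus>x\<in>?J. ?f x l)" using f l by (intro finsum_power_module_apply) auto
  also have "\<dots> = (\<Oplus>i\<in>{..<n}. \<Oplus>j\<in>{..<k}. ?f (i, j) l)"
    using m l by (intro finsum_Times) auto
  also have "\<dots> = (\<Oplus>i\<in>{..<n}. if l = i then m l else \<zero>)"
  proof (rule finsum_cong'[OF refl])
    fix i assume i: "i \<in> {..<n}"
    show "(\<Oplus>j\<in>{..<k}. ?f (i, j) l) = (if l = i then m l else \<zero>)"
    proof (cases "l = i")
      case True
      have "(\<Oplus>j\<in>{..<k}. ?f (i, j) l) = (\<Oplus>j\<in>{..<k}. coord j (m i) \<otimes> e j)"
        using True m i by (intro finsum_cong') (auto simp: unit_vector_def)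
      then show ?thesis using True expansion m l by simp
    next
      case False
      have "(\<Oplus>j\<in>{..<k}. ?f (i, j) l) = (\<Oplus>j\<in>{..<k}. \<zero>)"
        using False m i l by (intro finsum_cong') (auto simp: unit_vector_def)
      then show ?thesis using False by simp
    qed
  qed (use m in auto)
  also have "\<dots> = m l" using l m by (intro finsum_singleton) auto
  finally show "finsum ?M ?f ?J l = m l" .
qed (use m in auto)

text \<open>These vectors encode the functional with value \<open>c (i, j)\<close> on the vector
  that has \<open>e j\<close> at position \<open>i\<close>: it is the sum of the pairings with them,
  weighted by \<open>e s\<close> on the left.\<close>

definition dual_vector :: "nat \<Rightarrow> (nat \<times> nat \<Rightarrow> 'a) \<Rightarrow> nat \<Rightarrow> nat \<Rightarrow> 'a" where
  "dual_vector n c s = (\<lambda>i\<in>{..<n}. \<Oplus>j\<in>{..<k}. \<beta> j s \<otimes> c (i, j))"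

lemma dual_vector_closed [simp]:
  assumes "s < k" "c \<in> {..<n} \<times> {..<k} \<rightarrow> carrier A"
  shows "dual_vector n c s \<in> carrier (power_module A n)"
  using assms by (auto simp: dual_vector_def power_module_carrier intro!: finsum_closed)

lemma dual_vector_nth [simp]:
  "s < k \<Longrightarrow> i < n \<Longrightarrow> c \<in> {..<n} \<times> {..<k} \<rightarrow> carrier A \<Longrightarrow> dual_vector n c s i \<in> carrier A"
  using power_module_nth[OF dual_vector_closed] .

text \<open>Unfolding the coordinates as sums over \<open>s\<close> and exchanging summations
  collects everything to the right of \<open>m i\<close> in entry \<open>i\<close> of the dual
  vector.\<close>

lemma functional_eq_pairings:
  assumes c: "c \<in> {..<n} \<times> {..<k} \<rightarrow> carrier A" and m: "m \<in> carrier (power_module A n)"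
  shows "(\<Oplus>x\<in>{..<n} \<times> {..<k}. coord (snd x) (m (fst x)) \<otimes> c x) =
    (\<Oplus>s\<in>{..<k}. e s \<otimes> pairing A n m (dual_vector n c s))"
proof -
  have c': "c (i, j) \<in> carrier A" if "i < n" "j < k" for i j using c that by auto
  have mi: "m i \<in> carrier A" if "i < n" for i using m that by simp
  have "(\<Oplus>x\<in>{..<n} \<times> {..<k}. coord (snd x) (m (fst x)) \<otimes> c x) =
      (\<Oplus>i\<in>{..<n}. \<Oplus>j\<in>{..<k}. coord j (m i) \<otimes> c (i, j))"
    using c' mi by (subst finsum_Times) auto
  also have "\<dots> = (\<Oplus>i\<in>{..<n}. \<Oplus>s\<in>{..<k}. e s \<otimes> (m i \<otimes> dual_vector n c s i))"
  proof (rule finsum_cong'[OF refl])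
    fix i assume i: "i \<in> {..<n}"
    have "(\<Oplus>j\<in>{..<k}. coord j (m i) \<otimes> c (i, j)) =
        (\<Oplus>j\<in>{..<k}. \<Oplus>s\<in>{..<k}. e s \<otimes> m i \<otimes> \<beta> j s \<otimes> c (i, j))"
      unfolding sandwich_def using c' mi i
      by (intro finsum_cong' refl finsum_ldistr) (auto intro!: finsum_closed)
    also have "\<dots> = (\<Oplus>s\<in>{..<k}. \<Oplus>j\<in>{..<k}. e s \<otimes> m i \<otimes> \<beta> j s \<otimes> c (i, j))"
      using c' mi i by (intro finsum_swap) auto
    also have "\<dots> = (\<Oplus>s\<in>{..<k}. e s \<otimes> (m i \<otimes> dual_vector n c s i))"
    proof (rule finsum_cong'[OF refl])
      fix s assume s: "s \<in> {..<k}"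
      have "(\<Oplus>j\<in>{..<k}. e s \<otimes> m i \<otimes> \<beta> j s \<otimes> c (i, j)) =
          (\<Oplus>j\<in>{..<k}. (e s \<otimes> m i) \<otimes> (\<beta> j s \<otimes> c (i, j)))"
        using c' mi i s by (intro finsum_cong') (auto simp: m_assoc)
      also have "\<dots> = (e s \<otimes> m i) \<otimes> dual_vector n c s i"
        using c' mi i s by (subst finsum_rdistr[symmetric]) (auto simp: dual_vector_def)
      also have "\<dots> = e s \<otimes> (m i \<otimes> dual_vector n c s i)"
        using mi i s c by (intro m_assoc) auto
      finally show "(\<Oplus>j\<in>{..<k}. e s \<otimes> m i \<otimes> \<beta> j s \<otimes> c (i, j)) = \<dots>" .
    qed (use mi i c in auto)
    finally show "(\<Oplus>j\<in>{..<k}. coord j (m i) \<otimes> c (i, j)) = \<dots>" .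
  qed (use mi c in \<open>auto intro!: finsum_closed\<close>)
  also have "\<dots> = (\<Oplus>s\<in>{..<k}. \<Oplus>i\<in>{..<n}. e s \<otimes> (m i \<otimes> dual_vector n c s i))"
    using mi c by (intro finsum_swap) auto
  also have "\<dots> = (\<Oplus>s\<in>{..<k}. e s \<otimes> pairing A n m (dual_vector n c s))"
    unfolding pairing_def using mi c
    by (intro finsum_cong' refl finsum_rdistr[symmetric]) (auto intro!: finsum_closed)
  finally show ?thesis .
qed

text \<open>Multiplying by the \<open>\<beta> l t\<close> on the right and by the \<open>e t\<close> on the left isolates \<open>w l\<close>.\<close>

lemma isolate_coefficient:
  assumes P: "ideal P A" and w: "w \<in> {..<k} \<rightarrow> carrier A" and l: "l < k"
    and h: "\<And>x. x \<in> carrier A \<Longrightarrow> (\<Oplus>s\<in>{..<k}. e s \<otimes> (x \<otimes> w s)) \<in> P"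
  shows "w l \<in> P"
proof -
  interpret P: ideal P A by fact
  have wc: "w s \<in> carrier A" if "s < k" for s using w that by auto
  have "(\<Oplus>t\<in>{..<k}. e t \<otimes> (\<Oplus>s\<in>{..<k}. e s \<otimes> (\<beta> l t \<otimes> w s))) \<in> P"
    using h l by (intro finsum_mem_ideal[OF P]) (auto intro: P.I_l_closed)
  also have "(\<Oplus>t\<in>{..<k}. e t \<otimes> (\<Oplus>s\<in>{..<k}. e s \<otimes> (\<beta> l t \<otimes> w s))) =
      (\<Oplus>t\<in>{..<k}. \<Oplus>s\<in>{..<k}. e t \<otimes> e s \<otimes> \<beta> l t \<otimes> w s)"
  proof (rule finsum_cong'[OF refl])
    fix t assume t: "t \<in> {..<k}"
    have "e t \<otimes> (\<Oplus>s\<in>{..<k}. e s \<otimes> (\<beta> l t \<otimes> w s)) = (\<Oplus>s\<in>{..<k}. e t \<otimes> (e s \<otimes> (\<beta> l t \<otimes> w s)))"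
      using t l wc by (intro finsum_rdistr) auto
    also have "\<dots> = (\<Oplus>s\<in>{..<k}. e t \<otimes> e s \<otimes> \<beta> l t \<otimes> w s)"
      using t l wc by (intro finsum_cong') (auto simp: m_assoc)
    finally show "e t \<otimes> (\<Oplus>s\<in>{..<k}. e s \<otimes> (\<beta> l t \<otimes> w s)) = \<dots>" .
  qed (use wc l in \<open>auto intro!: finsum_closed\<close>)
  also have "\<dots> = (\<Oplus>s\<in>{..<k}. \<Oplus>t\<in>{..<k}. e t \<otimes> e s \<otimes> \<beta> l t \<otimes> w s)"
    using wc l by (intro finsum_swap) auto
  also have "\<dots> = (\<Oplus>s\<in>{..<k}. if l = s then w s else \<zero>)"
  proof (rule finsum_cong'[OF refl])
    fix s assume s: "s \<in> {..<k}"
    \<comment> \<open>The inner sum is the coordinate of \<open>e s\<close> at index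
      \<open>l\<close>, so only the term with \<open>s = l\<close> survives.\<close>
    have "(\<Oplus>t\<in>{..<k}. e t \<otimes> e s \<otimes> \<beta> l t \<otimes> w s) = coord l (e s) \<otimes> w s"
      unfolding sandwich_def using s l wc by (intro finsum_ldistr[symmetric]) auto
    also have "\<dots> = (if l = s then w s else \<zero>)" using s l wc coord_e by auto
    finally show "(\<Oplus>t\<in>{..<k}. e t \<otimes> e s \<otimes> \<beta> l t \<otimes> w s) = \<dots>" .
  qed (use wc in auto)
  also have "\<dots> = w l" using l wc by (intro finsum_singleton) auto
  finally show ?thesis .
qed

text \<open>For central \<open>b\<close> the element \<open>a \<otimes> x \<otimes> b\<close> equals
  \<open>a \<otimes> b \<otimes> x\<close>, so a single product in \<open>P\<close> already gives
  the two-sided condition for all \<open>x\<close>.\<close>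

lemma primeideal_center:
  assumes P: "two_sided_prime_ideal A P" and one: "\<one> \<notin> P"
  shows "primeideal (P \<inter> ring_center A) center_ring"
proof -
  interpret P: ideal P A using P by (simp add: two_sided_prime_ideal_def)
  interpret Z: cring center_ring by (rule cring_center_ring)
  note Zsub = subcring.axioms(1)[OF subcring_ring_center]
  show ?thesis
  proof (rule primeidealI[OF _ Z.is_cring])
    show "ideal (P \<inter> ring_center A) center_ring"
    proof (rule idealI[OF Z.ring_axioms])
      show "subgroup (P \<inter> ring_center A) (add_monoid center_ring)"
      proof (rule Z.add.subgroupI)
        show "P \<inter> ring_center A \<noteq> {}" 
          using subringE(2)[OF Zsub] additive_subgroup.zero_closed[OF ideal.axioms(1)[OF P.ideal_axioms]]
          by blast
        fix x assume x: "x \<in> P \<inter> ring_center A"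
        then have n: "\<ominus> x \<in> P \<inter> ring_center A" using subringE(5)[OF Zsub] by auto
        have "\<ominus>\<^bsub>center_ring\<^esub> x = \<ominus> x"
          using x n ring_centerD(1)[of x A] by (intro Z.minus_equality) (auto simp: l_neg)
        then show "\<ominus>\<^bsub>center_ring\<^esub> x \<in> P \<inter> ring_center A" using n by simp
      qed (use subringE(7)[OF Zsub] in \<open>auto intro: P.a_closed\<close>)
    qed (use subringE(6)[OF Zsub] ring_centerD(1)[of _ A] in \<open>auto intro: P.I_l_closed P.I_r_closed\<close>)
    show "carrier center_ring \<noteq> P \<inter> ring_center A" using one subringE(3)[OF Zsub] by auto
    fix a b assume a: "a \<in> carrier center_ring" and b: "b \<in> carrier center_ring"
      and ab: "a \<otimes>\<^bsub>center_ring\<^esub> b \<in> P \<inter> ring_center A"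
    have c: "a \<in> carrier A" "b \<in> carrier A" using a b ring_centerD(1)[of _ A] by auto
    have "a \<otimes> x \<otimes> b \<in> P" if x: "x \<in> carrier A" for x
    proof -
      have "a \<otimes> x \<otimes> b = (a \<otimes> b) \<otimes> x"
        using c x b ring_centerD(2)[of b A x] by (simp add: m_assoc)
      then show ?thesis using ab x by (simp add: P.I_r_closed)
    qed
    then show "a \<in> P \<inter> ring_center A \<or> b \<in> P \<inter> ring_center A"
      using P a b c unfolding two_sided_prime_ideal_def by auto
  qed
qed

lemma P_prime_submodule_separation:
  assumes P: "two_sided_prime_ideal A P" and L: "P_prime_submodule A (power_module A n) P L"
    and w: "w \<in> carrier (power_module A n)" "w \<notin> L"
  obtains u where "u \<in> carrier (power_module A n)" "u \<notin> {..<n} \<rightarrow>\<^sub>E P"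
    "L \<subseteq> C_submodule A n P u" "w \<notin> C_submodule A n P u"
proof -
  let ?M = "power_module A n"
  interpret P: ideal P A using P by (simp add: two_sided_prime_ideal_def)
  interpret M: module center_ring ?M by (rule module_power_module_center)
  have sub: "submodule L A ?M" and colon: "module_colon A ?M L = P"
    and prime: "\<And>a m. a \<in> carrier A \<Longrightarrow> m \<in> carrier ?M \<Longrightarrow>
      (\<And>b. b \<in> carrier A \<Longrightarrow> (a \<otimes> b) \<odot>\<^bsub>?M\<^esub> m \<in> L) \<Longrightarrow> a \<in> P \<or> m \<in> L"
    using L unfolding P_prime_submodule_def prime_submodule_def by auto
  note props = power_submodule_props[OF sub]
  have PM: "r \<odot>\<^bsub>?M\<^esub> x \<in> L" if "r \<in> P" "x \<in> carrier ?M" for r x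
    using that unfolding colon[symmetric] module_colon_def by blast
  \<comment> \<open>\<open>P\<close> is not assumed proper. If it were the whole ring,
    \<open>L\<close> would be the whole module and contain \<open>w\<close>.\<close>
  have one: "\<one> \<notin> P"
  proof
    assume "\<one> \<in> P"
    then have "\<one> \<odot>\<^bsub>?M\<^esub> w \<in> L" using PM w by blast
    moreover have "\<one> \<odot>\<^bsub>?M\<^esub> w = w" using w by (intro power_module_eqI[of _ n]) auto
    ultimately show False using w by simp
  qed
  let ?p = "P \<inter> ring_center A" and ?J = "{..<n} \<times> {..<k}"
  \<comment> \<open>A central \<open>r\<close> commutes with every \<open>b\<close>, so
    \<open>r\<close> times \<open>x\<close> in the left submodule \<open>L\<close> brings in all
    \<open>r \<otimes> b\<close> times \<open>x\<close>. The prime condition then applies.\<close>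
  have sat: "M.saturated ?p L" unfolding M.saturated_def
  proof (intro ballI impI)
    fix r x assume r: "r \<in> carrier center_ring - ?p" and x: "x \<in> carrier ?M" and rx: "r \<odot>\<^bsub>?M\<^esub> x \<in> L"
    have rc: "r \<in> carrier A" "r \<in> ring_center A" "r \<notin> P" using r ring_centerD(1)[of r A] by auto
    have "(r \<otimes> b) \<odot>\<^bsub>?M\<^esub> x \<in> L" if b: "b \<in> carrier A" for b
    proof -
      have "(r \<otimes> b) \<odot>\<^bsub>?M\<^esub> x = b \<odot>\<^bsub>?M\<^esub> (r \<odot>\<^bsub>?M\<^esub> x)"
        using rc b x ring_centerD(2)[OF rc(2) b] by (simp add: power_module_smult_assoc[symmetric])
      then show ?thesis using props(4)[OF b rx] by simp
    qed
    then show "x \<in> L" using prime[OF rc(1) x] rc by blast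
  qed
  \<comment> \<open>\<open>c\<close> lists the values of a functional over the centre on the vectors
    with a single nonzero entry \<open>e j\<close>.\<close>
  obtain c where c: "c \<in> ?J \<rightarrow> carrier center_ring"
    and cL: "\<And>z. z \<in> ?J \<rightarrow> carrier center_ring \<Longrightarrow>
      (\<Oplus>\<^bsub>?M\<^esub>x\<in>?J. z x \<odot>\<^bsub>?M\<^esub> unit_vector n (fst x) (e (snd x))) \<in> L \<Longrightarrow>
      (\<Oplus>\<^bsub>center_ring\<^esub>x\<in>?J. z x \<otimes>\<^bsub>center_ring\<^esub> c x) \<in> ?p"
    and cw: "\<And>z. z \<in> ?J \<rightarrow> carrier center_ring \<Longrightarrow>
      (\<Oplus>\<^bsub>?M\<^esub>x\<in>?J. z x \<odot>\<^bsub>?M\<^esub> unit_vector n (fst x) (e (snd x))) = w \<Longrightarrow>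
      (\<Oplus>\<^bsub>center_ring\<^esub>x\<in>?J. z x \<otimes>\<^bsub>center_ring\<^esub> c x) \<notin> ?p"
    by (rule M.separating_functional[OF primeideal_center[OF P one] submodule_center[OF sub] sat _ w,
          of ?J "\<lambda>x. unit_vector n (fst x) (e (snd x))"]) (use PM in auto)
  have cA: "c \<in> ?J \<rightarrow> carrier A" using c ring_centerD(1)[of _ A] by auto
  note Zsub = subcring.axioms(1)[OF subcring_ring_center]
  define \<phi> where "\<phi> m = (\<Oplus>x\<in>?J. coord (snd x) (m (fst x)) \<otimes> c x)" for m
  have z: "(\<lambda>x. coord (snd x) (m (fst x))) \<in> ?J \<rightarrow> carrier center_ring" if "m \<in> carrier ?M" for m
    using that coord_central by auto
  \<comment> \<open>Sums in the centre and in \<open>A\<close> agree, so the functional can be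
    rewritten with factors from \<open>A\<close> that are not central.\<close>
  have \<phi>_Z: "(\<Oplus>\<^bsub>center_ring\<^esub>x\<in>?J. coord (snd x) (m (fst x)) \<otimes>\<^bsub>center_ring\<^esub> c x) = \<phi> m"
    and \<phi>_mem: "\<phi> m \<in> ring_center A" if m: "m \<in> carrier ?M" for m
  proof -
    have mem: "(\<lambda>x. coord (snd x) (m (fst x)) \<otimes> c x) \<in> ?J \<rightarrow> ring_center A"
      using z[OF m] c subringE(6)[OF Zsub] by (auto simp: Pi_iff)
    then show 1: "(\<Oplus>\<^bsub>center_ring\<^esub>x\<in>?J. coord (snd x) (m (fst x)) \<otimes>\<^bsub>center_ring\<^esub> c x) = \<phi> m"
      using finsum_carrier_restrict[OF Zsub _ mem] by (simp add: \<phi>_def)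
    show "\<phi> m \<in> ring_center A"
      using mem M.R.finsum_closed[of "\<lambda>x. coord (snd x) (m (fst x)) \<otimes> c x" ?J] 1 by simp
  qed
  have \<phi>L: "\<phi> m \<in> P" if "m \<in> L" for m
  proof -
    have m: "m \<in> carrier ?M" using that props(1) by blast
    show ?thesis using cL[OF z[OF m]] power_module_expansion[OF m] that \<phi>_Z[OF m] by simp
  qed
  have \<phi>w: "\<phi> w \<notin> P"
    using cw[OF z[OF w(1)] power_module_expansion[OF w(1)]] \<phi>_Z[OF w(1)] \<phi>_mem[OF w(1)] by simp
  let ?u = "dual_vector n c"
  have \<phi>_pair: "\<phi> m = (\<Oplus>s\<in>{..<k}. e s \<otimes> pairing A n m (?u s))" if "m \<in> carrier ?M" for m
    unfolding \<phi>_def by (rule functional_eq_pairings[OF cA that])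
  have u: "?u s \<in> carrier ?M" if "s < k" for s using that cA by simp
  \<comment> \<open>\<open>\<phi> w\<close> is a left combination of these pairings, so they cannot
    all lie in \<open>P\<close>.\<close>
  obtain s where s: "s < k" "pairing A n w (?u s) \<notin> P"
  proof (rule ccontr)
    assume "\<not> thesis"
    then have "\<And>s. s < k \<Longrightarrow> pairing A n w (?u s) \<in> P" using that by blast
    then have "\<phi> w \<in> P" unfolding \<phi>_pair[OF w(1)]
      by (intro finsum_mem_ideal[OF P.ideal_axioms]) (auto intro: P.I_l_closed)
    then show False using \<phi>w by blast
  qed
  \<comment> \<open>\<open>L\<close> is a left submodule, so the functional can be tested at all
    multiples of \<open>m\<close>; this is what isolating one coefficient requires.\<close>
  have "pairing A n m (?u s) \<in> P" if m: "m \<in> L" for m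
  proof (rule isolate_coefficient[OF P.ideal_axioms _ s(1)])
    have mM: "m \<in> carrier ?M" using m props(1) by blast
    show "(\<lambda>s. pairing A n m (?u s)) \<in> {..<k} \<rightarrow> carrier A" using mM u by auto
    fix x assume x: "x \<in> carrier A"
    have "\<phi> (x \<odot>\<^bsub>?M\<^esub> m) \<in> P" using \<phi>L props(4)[OF x m] by blast
    also have "\<phi> (x \<odot>\<^bsub>?M\<^esub> m) = (\<Oplus>s\<in>{..<k}. e s \<otimes> (x \<otimes> pairing A n m (?u s)))"
      unfolding \<phi>_pair[OF power_module_closed(2)[OF x mM]]
      using x mM u by (intro finsum_cong') (auto simp: pairing_smult_left)
    finally show "(\<Oplus>s\<in>{..<k}. e s \<otimes> (x \<otimes> pairing A n m (?u s))) \<in> P" .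
  qed
  then have "L \<subseteq> C_submodule A n P (?u s)" using props(1) by (auto simp: C_submodule_def)
  moreover have "w \<notin> C_submodule A n P (?u s)" using s by (simp add: C_submodule_def)
  moreover have "?u s \<notin> {..<n} \<rightarrow>\<^sub>E P"
  proof
    assume "?u s \<in> {..<n} \<rightarrow>\<^sub>E P"
    then have "pairing A n w (?u s) \<in> P" unfolding pairing_def
      using w by (intro finsum_mem_ideal[OF P.ideal_axioms] P.I_l_closed) auto
    then show False using s by blast
  qed
  ultimately show thesis using that u[OF s(1)] by blast
qed

text \<open>Each member of the family is a \<open>P\<close>-prime submodule over \<open>N\<close>.
  Conversely, a vector outside a \<open>P\<close>-prime \<open>L\<close> over \<open>N\<close> is
  excluded by some member that contains \<open>L\<close>. Intersecting with the carrier gives the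
  empty family its intended value.\<close>

theorem prime_hull_eq_Inter_C_submodule:
  assumes P: "two_sided_prime_ideal A P" and N: "N \<subseteq> carrier (power_module A n)"
  shows "prime_hull A (power_module A n) N P = carrier (power_module A n) \<inter>
    \<Inter> {C_submodule A n P u | u.
        u \<in> carrier (power_module A n) - ({..<n} \<rightarrow>\<^sub>E P) \<and> N \<subseteq> C_submodule A n P u}"
    (is "_ = carrier ?M \<inter> \<Inter>?\<C>")
proof -
  have \<C>: "P_prime_submodule A ?M P C \<and> N \<subseteq> C" if "C \<in> ?\<C>" for C
    using that P_prime_submodule_C_submodule[OF P] by blast
  have least: "carrier ?M \<inter> \<Inter>?\<C> \<subseteq> L" if L: "P_prime_submodule A ?M P L" "N \<subseteq> L" for L
  proof
    fix w assume w: "w \<in> carrier ?M \<inter> \<Inter>?\<C>"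
    show "w \<in> L"
    proof (rule ccontr)
      assume "w \<notin> L"
      with w obtain u where u: "u \<in> carrier ?M" "u \<notin> {..<n} \<rightarrow>\<^sub>E P"
        "L \<subseteq> C_submodule A n P u" "w \<notin> C_submodule A n P u"
        using P_prime_submodule_separation[OF P L(1), of w] by blast
      then have "C_submodule A n P u \<in> ?\<C>" using L(2) by blast
      then show False using w u(4) by blast
    qed
  qed
  show ?thesis
  proof (cases "\<exists>L. P_prime_submodule A ?M P L \<and> N \<subseteq> L")
    case True
    have "P_prime_submodule A ?M P (carrier ?M \<inter> \<Inter>?\<C>)"
    proof (cases "?\<C> = {}")
      \<comment> \<open>Here the intersection is the whole module, and \<open>least\<close> forces
        the given \<open>L\<close> to be the whole module too. So the latter is
        \<open>P\<close>-prime.\<close>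
      case \<C>_empty: True
      from True obtain L where L: "P_prime_submodule A ?M P L" "N \<subseteq> L" by blast
      then have "L \<subseteq> carrier ?M"
        unfolding P_prime_submodule_def prime_submodule_def using power_submodule_props(1) by blast
      then have "carrier ?M \<inter> \<Inter>?\<C> = L" using least[OF L] unfolding \<C>_empty by auto
      then show ?thesis using L(1) by simp
    next
      case False
      have "\<Inter>?\<C> \<subseteq> carrier ?M" using False by (auto simp: C_submodule_def)
      then have "carrier ?M \<inter> \<Inter>?\<C> = \<Inter>?\<C>" by blast
      moreover have "P_prime_submodule A ?M P (\<Inter>?\<C>)"
        by (rule P_prime_submodule_Inter[OF False]) (use \<C> in blast)
      ultimately show ?thesis by (simp only:)
    qed
    moreover have "N \<subseteq> carrier ?M \<inter> \<Inter>?\<C>" using N \<C> by blast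
    ultimately have "(LEAST L. P_prime_submodule A ?M P L \<and> N \<subseteq> L) = carrier ?M \<inter> \<Inter>?\<C>"
      using least by (intro Least_equality) auto
    then show ?thesis using True by (simp add: prime_hull_def)
  next
    case False
    \<comment> \<open>A member would itself be a \<open>P\<close>-prime submodule containing
      \<open>N\<close>.\<close>
    then have "?\<C> = {}" using \<C> by blast
    then have "carrier ?M \<inter> \<Inter>?\<C> = carrier ?M" by (simp only: Inter_empty Int_UNIV_right)
    then show ?thesis using False by (simp only: prime_hull_def if_False)
  qed
qed

end

section \<open>The tensor product of a central division algebra with a commutative algebra\<close>

theorem theorem4:
  fixes F :: "('f, 'a) ring_scheme"
    and D :: "('f, 'd, 'b) module_scheme"
    and R :: "('f, 'r, 'c) module_scheme"
    and D\<^sub>R :: "('d \<times> 'r \<Rightarrow>\<^sub>0 int) set ring"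
    and n :: nat
  assumes "fin_dim_central_division_algebra F D"
    and "algebra F R"
    and "D\<^sub>R = tensor_algebra F D R"
    and "n > 0"
    and "submodule N D\<^sub>R (power_module D\<^sub>R n)"
    and "two_sided_prime_ideal D\<^sub>R P"
  shows "prime_hull D\<^sub>R (power_module D\<^sub>R n) N P =
    carrier (power_module D\<^sub>R n) \<inter>
    \<Inter> {C_submodule D\<^sub>R n P u | u.
        u \<in> carrier (power_module D\<^sub>R n) - ({..<n} \<rightarrow>\<^sub>E P) \<and> N \<subseteq> C_submodule D\<^sub>R n P u}"
proof -
  interpret FD: fin_dim_central_division_algebra F D by fact
  interpret FR: algebra F R by fact
  interpret DR: algebra_tensor_product F D R ..
  interpret S: skew_field D
    using FD.one_neq_zero FD.division by unfold_locales auto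
  \<comment> \<open>Centrality identifies the scalars from \<open>F\<close> with the centre of
    \<open>D\<close>, so finite dimension over \<open>F\<close> is finite dimension over the
    centre.\<close>
  obtain k e \<beta> where "sandwich_basis D k e \<beta>"
    using S.exists_sandwich_basis FD.fin_dim unfolding FD.central by blast
  from DR.sandwich_basis_tensor[OF this]
  interpret B: sandwich_basis D\<^sub>R k "\<lambda>s. pure_tensor F D R (e s) \<one>\<^bsub>R\<^esub>" "\<lambda>j s. pure_tensor F D R (\<beta> j s) \<one>\<^bsub>R\<^esub>"
    unfolding assms(3) .
  show ?thesis
    using B.prime_hull_eq_Inter_C_submodule[OF assms(6)] B.power_submodule_props(1)[OF assms(5)] by blast
qed

end
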